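(* Let $(W,S)$ be a finite Coxeter system with longest element $w_0$, realized in $V$, and let $T>0$. For any dominant path $\pi\in C_T^0(V)$, the set $$L_\pi=\{\eta\in C_T^0(V):\ \mathcal P_{w_0}\eta=\pi\},$$ with the crystal structure induced from $C^0_T(V)$, is a normal continuous crystal with highest weight $\pi(T)$.
   Context: **Realization.** $V$ is a finite-dimensional real vector space with dual $V^\vee$, on which the finite Coxeter group $W$ (generated by the finite set of involutions $S$) acts so that $s(x)=x-\alpha_s^\vee(x)\alpha_s$ for $s\in S$, where $(\alpha_s,\alpha_s^\vee)\in V\times V^\vee$, $\alpha_s^\vee(\alpha_s)=2$. With $m(s,s')$ the order of $ss'$, as is standard, for $s\neq s'$: $\alpha_s^\vee(\alpha_{s'})=\alpha_{s'}^\vee(\alpha_s)=0$ if $m(s,s')=2$, otherwise both are negative with product $4\cos^2(\pi/m(s,s'))$. $\Sigma=\{\alpha_s\}$; for $\alpha=\alpha_s$, $\alpha^\vee=\alpha_s^\vee$. $\overline C=\{v\in V:\alpha^\vee(v)\ge0\ \forall\alpha\in\Sigma\}$. **Paths and Pitman transforms.** $C_T^0(V)$ is the set of continuous paths $\eta:[0,T]\to V$ with $\eta(0)=0$. A path is dominant if it takes values in $\overline C$. For $\alpha\in\Sigma$, $\mathcal P_\alpha\eta(t)=\eta(t)-\inf_{0\le s\le t}\alpha^\vee(\eta(s))\,\alpha$. For a reduced decomposition $w=s_1\cdots s_r$, $\mathcal P_w=\mathcal P_{\alpha_{s_1}}\cdots\mathcal P_{\alpha_{s_r}}$, which does not depend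 on the decomposition. **Continuous crystal.** A set $B$ with maps $wt:B\to V$, $\varepsilon_\alpha,\varphi_\alpha:B\to\mathbb R\cup\{-\infty\}$, $e_\alpha^r:B\cup\{\mathbf 0\}\to B\cup\{\mathbf 0\}$ ($\alpha\in\Sigma,r\in\mathbb R$, $\mathbf 0$ a ghost element) such that (C1) $\varphi_\alpha(b)=\varepsilon_\alpha(b)+\alpha^\vee(wt(b))$; (C2) if $e_\alpha^r(b)\ne\mathbf 0$ then $\varepsilon_\alpha(e_\alpha^rb)=\varepsilon_\alpha(b)-r$, $\varphi_\alpha(e_\alpha^rb)=\varphi_\alpha(b)+r$, $wt(e_\alpha^rb)=wt(b)+r\alpha$; (C3) $e_\alpha^r(\mathbf 0)=\mathbf 0$, $e_\alpha^0(b)=b$, and if $e_\alpha^r(b)\ne\mathbf 0$ then $e_\alpha^{s+r}(b)=e_\alpha^s(e_\alpha^r(b))$ for all $s$; (C4) if $\varphi_\alpha(b)=-\infty$ then $e_\alpha^r(b)=\mathbf 0$ for $r\ne0$. It is normal if $\varepsilon_\alpha(b)=\max\{r\ge0:e_\alpha^r(b)\neq\mathbf 0\}$ and $\varphi_\alpha(b)=\max\{r\ge0:e_\alpha^{-r}(b)\ne\mathbf 0\}$ for all $b,\alpha$. It has highest weight $\lambda$ if there is $b_\lambda\in B$ with $wt(b_\lambda)=\lambda$, $e_\alpha^r(b_\lambda)=\mathbf 0$ for all $r>0$ and $\alpha\in\Sigma$, and every element of $B$ is of the form $e_{\alpha_1}^{-r_1}\cdots e_{\alpha_k}^{-r_k}b_\lambda$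 with $\alpha_i\in\Sigma$, $r_i\ge0$. **Crystal structure on paths.** On $C_T^0(V)$: $wt(\eta)=\eta(T)$, $\varepsilon_\alpha(\eta)=-\inf_{0\le t\le T}\alpha^\vee(\eta(t))$, $\varphi_\alpha(\eta)=\alpha^\vee(\eta(T))-\inf_{0\le t\le T}\alpha^\vee(\eta(t))$, and $e_\alpha^x\eta=\mathcal E_\alpha^x\eta$, where for $-\varphi_\alpha(\eta)\le x\le\varepsilon_\alpha(\eta)$, $\mathcal E_\alpha^x\eta$ is the unique path in $C^0_T(V)$ with $\mathcal P_\alpha\mathcal E_\alpha^x\eta=\mathcal P_\alpha\eta$ and $\mathcal E_\alpha^x\eta(T)=\eta(T)+x\alpha$, and $\mathcal E_\alpha^x\eta=\mathbf 0$ otherwise. *)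

theory Defs
  imports "HOL-Analysis.Analysis" "HOL-Algebra.Group_Action" "HOL-Algebra.Multiplicative_Group"
    "HOL-Algebra.Generated_Groups"
begin

section \<open>Coxeter systems\<close>

definition word_value :: "('g, 'm) monoid_scheme \<Rightarrow> 'g list \<Rightarrow> 'g" where
  "word_value W ws = foldr (\<otimes>\<^bsub>W\<^esub>) ws \<one>\<^bsub>W\<^esub>"

text \<open>The congruence on the free monoid over \<open>S\<close> generated by the Coxeter relators
  \<open>(s t)\<^sup>m = 1\<close>, where \<open>m\<close> is the order of \<open>s t\<close>. The case \<open>s = t\<close> gives
  \<open>s s = 1\<close> when \<open>s\<close> is an involution, so the quotient monoid is then the group with the
  Coxeter presentation. An infinite order is \<open>0\<close> in the library and gives no relation.\<close>

inductive coxeter_equiv :: "('g, 'm) monoid_scheme \<Rightarrow> 'g set \<Rightarrow> 'g list \<Rightarrow> 'g list \<Rightarrow> bool"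
  for W (structure) and S where
  refl: "u \<in> lists S \<Longrightarrow> coxeter_equiv W S u u"
| sym: "coxeter_equiv W S u v \<Longrightarrow> coxeter_equiv W S v u"
| trans: "coxeter_equiv W S u v \<Longrightarrow> coxeter_equiv W S v w \<Longrightarrow> coxeter_equiv W S u w"
| relator: "u \<in> lists S \<Longrightarrow> v \<in> lists S \<Longrightarrow> s \<in> S \<Longrightarrow> t \<in> S \<Longrightarrow>
    coxeter_equiv W S (u @ concat (replicate (group.ord W (s \<otimes> t)) [s, t]) @ v) (u @ v)"

locale coxeter_system = group W for W :: "('g, 'm) monoid_scheme" (structure) +
  fixes S :: "'g set"
  assumes finite_S: "finite S"
    and S_carrier: "S \<subseteq> carrier W"
    and involution: "s \<in> S \<Longrightarrow> s \<noteq> \<one> \<and> s \<otimes> s = \<one>"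
    and generators: "generate W S = carrier W"
    and presentation: "u \<in> lists S \<Longrightarrow> v \<in> lists S \<Longrightarrow>
      word_value W u = word_value W v \<Longrightarrow> coxeter_equiv W S u v"

definition coxeter_length :: "('g, 'm) monoid_scheme \<Rightarrow> 'g set \<Rightarrow> 'g \<Rightarrow> nat" where
  "coxeter_length W S w = (LEAST n. \<exists>ws\<in>lists S. length ws = n \<and> word_value W ws = w)"

definition reduced_decomposition ::
  "('g, 'm) monoid_scheme \<Rightarrow> 'g set \<Rightarrow> 'g \<Rightarrow> 'g list \<Rightarrow> bool" where
  "reduced_decomposition W S w ws \<longleftrightarrow>
    ws \<in> lists S \<and> word_value W ws = w \<and> length ws = coxeter_length W S w"

definition longest_element :: "('g, 'm) monoid_scheme \<Rightarrow> 'g set \<Rightarrow> 'g \<Rightarrow> bool" where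
  "longest_element W S w0 \<longleftrightarrow>
    w0 \<in> carrier W \<and> (\<forall>w\<in>carrier W. coxeter_length W S w \<le> coxeter_length W S w0)"

section \<open>Realizations\<close>

text \<open>The norm on \<open>V\<close> only serves to provide its canonical topology: on a finite-dimensional
  real vector space all norms are equivalent, and \<open>linear\<close> functionals make up the whole dual.
  Roots and coroots are indexed by \<open>S\<close> (the coroot conditions make \<open>s \<mapsto> \<alpha>\<^sub>s\<close> injective), so
  \<open>s \<in> S\<close> stands for \<open>\<alpha>\<^sub>s \<in> \<Sigma>\<close> throughout.\<close>

locale coxeter_realization = coxeter_system W S
  for W :: "('g, 'm) monoid_scheme" (structure) and S +
  fixes act :: "'g \<Rightarrow> 'v \<Rightarrow> 'v::real_normed_vector"
    and sroot :: "'g \<Rightarrow> 'v"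
    and coroot :: "'g \<Rightarrow> 'v \<Rightarrow> real"
  assumes finite_dimensional: "\<exists>B::'v set. finite B \<and> span B = UNIV"
    and action: "group_action W UNIV act"
    and action_linear: "w \<in> carrier W \<Longrightarrow> linear (act w)"
    and coroot_linear: "s \<in> S \<Longrightarrow> linear (coroot s)"
    and coroot_root: "s \<in> S \<Longrightarrow> coroot s (sroot s) = 2"
    and reflection: "s \<in> S \<Longrightarrow> act s x = x - coroot s x *\<^sub>R sroot s"
    and commuting: "s \<in> S \<Longrightarrow> t \<in> S \<Longrightarrow> s \<noteq> t \<Longrightarrow> group.ord W (s \<otimes> t) = 2 \<Longrightarrow>
      coroot s (sroot t) = 0 \<and> coroot t (sroot s) = 0"
    and noncommuting: "s \<in> S \<Longrightarrow> t \<in> S \<Longrightarrow> s \<noteq> t \<Longrightarrow> group.ord W (s \<otimes> t) \<noteq> 2 \<Longrightarrow>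
      coroot s (sroot t) < 0 \<and> coroot t (sroot s) < 0 \<and>
      coroot s (sroot t) * coroot t (sroot s) = 4 * (cos (pi / real (group.ord W (s \<otimes> t))))\<^sup>2"

definition closed_chamber :: "'i set \<Rightarrow> ('i \<Rightarrow> 'v \<Rightarrow> real) \<Rightarrow> 'v set" where
  "closed_chamber S coroot = {v. \<forall>s\<in>S. 0 \<le> coroot s v}"

section \<open>Paths and Pitman transforms\<close>

definition paths :: "real \<Rightarrow> (real \<Rightarrow> 'v::real_normed_vector) set" where
  "paths T = {\<eta> \<in> extensional {0..T}. continuous_on {0..T} \<eta> \<and> \<eta> 0 = 0}"

definition dominant :: "'i set \<Rightarrow> ('i \<Rightarrow> 'v \<Rightarrow> real) \<Rightarrow> real \<Rightarrow> (real \<Rightarrow> 'v) \<Rightarrow> bool" where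
  "dominant S coroot T \<eta> \<longleftrightarrow> (\<forall>t\<in>{0..T}. \<eta> t \<in> closed_chamber S coroot)"

definition pitman ::
  "('i \<Rightarrow> 'v::real_normed_vector) \<Rightarrow> ('i \<Rightarrow> 'v \<Rightarrow> real) \<Rightarrow> real \<Rightarrow> 'i \<Rightarrow> (real \<Rightarrow> 'v) \<Rightarrow> (real \<Rightarrow> 'v)"
  where
  "pitman sroot coroot T s \<eta> =
    (\<lambda>t\<in>{0..T}. \<eta> t - (INF u\<in>{0..t}. coroot s (\<eta> u)) *\<^sub>R sroot s)"

definition pitman_word ::
  "('i \<Rightarrow> 'v::real_normed_vector) \<Rightarrow> ('i \<Rightarrow> 'v \<Rightarrow> real) \<Rightarrow> real \<Rightarrow>
    'i list \<Rightarrow> (real \<Rightarrow> 'v) \<Rightarrow> (real \<Rightarrow> 'v)" where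
  "pitman_word sroot coroot T ws = foldr (pitman sroot coroot T) ws"

text \<open>Any reduced decomposition may be used: on paths the result does not depend on it.\<close>

definition pitman_elt ::
  "('g, 'm) monoid_scheme \<Rightarrow> 'g set \<Rightarrow> ('g \<Rightarrow> 'v::real_normed_vector) \<Rightarrow> ('g \<Rightarrow> 'v \<Rightarrow> real) \<Rightarrow>
    real \<Rightarrow> 'g \<Rightarrow> (real \<Rightarrow> 'v) \<Rightarrow> (real \<Rightarrow> 'v)" where
  "pitman_elt W S sroot coroot T w =
    pitman_word sroot coroot T (SOME ws. reduced_decomposition W S w ws)"

section \<open>Continuous crystals\<close>

text \<open>\<open>None\<close> is the ghost element, and \<open>I\<close> indexes the simple roots. The codomain
  \<open>\<real> \<union> {-\<infinity>}\<close> is \<open>ereal\<close> without \<open>\<infinity>\<close>.\<close>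

locale continuous_crystal =
  fixes I :: "'i set"
    and sroot :: "'i \<Rightarrow> 'v::real_vector"
    and coroot :: "'i \<Rightarrow> 'v \<Rightarrow> real"
    and B :: "'b set"
    and wt :: "'b \<Rightarrow> 'v"
    and eps phi :: "'i \<Rightarrow> 'b \<Rightarrow> ereal"
    and e :: "'i \<Rightarrow> real \<Rightarrow> 'b option \<Rightarrow> 'b option"
  assumes codomain: "i \<in> I \<Longrightarrow> b \<in> B \<Longrightarrow> eps i b \<noteq> \<infinity> \<and> phi i b \<noteq> \<infinity>"
    and closed: "i \<in> I \<Longrightarrow> b \<in> B \<Longrightarrow> e i r (Some b) \<in> insert None (Some ` B)"
    and C1: "i \<in> I \<Longrightarrow> b \<in> B \<Longrightarrow> phi i b = eps i b + ereal (coroot i (wt b))"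
    and C2: "i \<in> I \<Longrightarrow> b \<in> B \<Longrightarrow> e i r (Some b) = Some c \<Longrightarrow>
      eps i c = eps i b - ereal r \<and> phi i c = phi i b + ereal r \<and> wt c = wt b + r *\<^sub>R sroot i"
    and C3_ghost: "i \<in> I \<Longrightarrow> e i r None = None"
    and C3_zero: "i \<in> I \<Longrightarrow> b \<in> B \<Longrightarrow> e i 0 (Some b) = Some b"
    and C3_add: "i \<in> I \<Longrightarrow> b \<in> B \<Longrightarrow> e i r (Some b) \<noteq> None \<Longrightarrow>
      e i (s + r) (Some b) = e i s (e i r (Some b))"
    and C4: "i \<in> I \<Longrightarrow> b \<in> B \<Longrightarrow> phi i b = -\<infinity> \<Longrightarrow> r \<noteq> 0 \<Longrightarrow> e i r (Some b) = None"

definition is_maximum :: "real set \<Rightarrow> ereal \<Rightarrow> bool" where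
  "is_maximum A x \<longleftrightarrow> (\<exists>m\<in>A. x = ereal m \<and> (\<forall>a\<in>A. a \<le> m))"

locale normal_continuous_crystal = continuous_crystal +
  assumes normal_eps: "i \<in> I \<Longrightarrow> b \<in> B \<Longrightarrow>
      is_maximum {r. 0 \<le> r \<and> e i r (Some b) \<noteq> None} (eps i b)"
    and normal_phi: "i \<in> I \<Longrightarrow> b \<in> B \<Longrightarrow>
      is_maximum {r. 0 \<le> r \<and> e i (- r) (Some b) \<noteq> None} (phi i b)"

definition has_highest_weight ::
  "'i set \<Rightarrow> 'b set \<Rightarrow> ('b \<Rightarrow> 'v) \<Rightarrow> ('i \<Rightarrow> real \<Rightarrow> 'b option \<Rightarrow> 'b option) \<Rightarrow> 'v \<Rightarrow> bool" where
  "has_highest_weight I B wt e wt_max \<longleftrightarrow>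
    (\<exists>b0\<in>B. wt b0 = wt_max \<and> (\<forall>i\<in>I. \<forall>r>0. e i r (Some b0) = None) \<and>
      (\<forall>b\<in>B. \<exists>irs. set irs \<subseteq> I \<times> {0..} \<and>
        Some b = foldr (\<lambda>(i, r). e i (- r)) irs (Some b0)))"

section \<open>The crystal structure on paths\<close>

definition path_wt :: "real \<Rightarrow> (real \<Rightarrow> 'v) \<Rightarrow> 'v" where
  "path_wt T \<eta> = \<eta> T"

definition path_eps :: "('i \<Rightarrow> 'v \<Rightarrow> real) \<Rightarrow> real \<Rightarrow> 'i \<Rightarrow> (real \<Rightarrow> 'v) \<Rightarrow> real" where
  "path_eps coroot T s \<eta> = - (INF t\<in>{0..T}. coroot s (\<eta> t))"

definition path_phi :: "('i \<Rightarrow> 'v \<Rightarrow> real) \<Rightarrow> real \<Rightarrow> 'i \<Rightarrow> (real \<Rightarrow> 'v) \<Rightarrow> real" where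
  "path_phi coroot T s \<eta> = coroot s (\<eta> T) - (INF t\<in>{0..T}. coroot s (\<eta> t))"

definition path_e ::
  "('i \<Rightarrow> 'v::real_normed_vector) \<Rightarrow> ('i \<Rightarrow> 'v \<Rightarrow> real) \<Rightarrow> real \<Rightarrow>
    'i \<Rightarrow> real \<Rightarrow> (real \<Rightarrow> 'v) option \<Rightarrow> (real \<Rightarrow> 'v) option" where
  "path_e sroot coroot T s x p = (case p of None \<Rightarrow> None | Some \<eta> \<Rightarrow>
    if - path_phi coroot T s \<eta> \<le> x \<and> x \<le> path_eps coroot T s \<eta>
    then Some (THE \<xi>. \<xi> \<in> paths T \<and> pitman sroot coroot T s \<xi> = pitman sroot coroot T s \<eta> \<and>
      \<xi> T = \<eta> T + x *\<^sub>R sroot s)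
    else None)"

definition pitman_fibre ::
  "('g, 'm) monoid_scheme \<Rightarrow> 'g set \<Rightarrow> ('g \<Rightarrow> 'v::real_normed_vector) \<Rightarrow> ('g \<Rightarrow> 'v \<Rightarrow> real) \<Rightarrow>
    real \<Rightarrow> 'g \<Rightarrow> (real \<Rightarrow> 'v) \<Rightarrow> (real \<Rightarrow> 'v) set" where
  "pitman_fibre W S sroot coroot T w0 \<pi> =
    {\<eta> \<in> paths T. pitman_elt W S sroot coroot T w0 \<eta> = \<pi>}"

end

theory Submission
  imports Defs
begin

text \<open>The string operators of \<open>s\<close> preserve \<open>\<P>\<^sub>s\<close>, and every path is determined by its Pitman
  transform \<open>\<P>\<^sub>s \<eta>\<close> together with its end point. So the fibre of \<open>\<P>\<close> for the longest element is
  stable under all string operators as soon as that transform factors through every \<open>\<P>\<^sub>s\<close>. As the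
  longest element has a reduced word ending in any given \<open>s\<close>, this follows from Matsumoto's theorem
  and the braid relations for the \<open>\<P>\<^sub>s\<close>. Any path is recovered from its transform by undoing the
  \<open>\<P>\<^sub>s\<close> one after the other, hence \<open>\<pi>\<close> generates the fibre.

  The braid relations come from a formula for alternating products of Pitman transforms in rank two
  due to Biane, Bougerol and O'Connell: the coefficients along the two roots are the infima of
  \<open>U\<^sub>1 a\<^sup>\<or>(\<eta> s\<^sub>1) + U\<^sub>2 b\<^sup>\<or>(\<eta> s\<^sub>2) + U\<^sub>3 a\<^sup>\<or>(\<eta> s\<^sub>3) + \<dots>\<close> over \<open>t \<ge> s\<^sub>1 \<ge> s\<^sub>2 \<ge> \<dots> \<ge> 0\<close>, where
  \<open>U\<^sub>n = sin (n\<pi>/m) / sin (\<pi>/m)\<close>. It is proved by splitting off the innermost transform. With \<open>m\<close>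
  factors the last term vanishes, which makes the formula symmetric in the two roots.\<close>

section \<open>Running infima\<close>

definition running_inf :: "(real \<Rightarrow> real) \<Rightarrow> real \<Rightarrow> real" where
  "running_inf f t = (INF u\<in>{0..t}. f u)"

lemma running_inf_cong:
  "(\<And>u. 0 \<le> u \<Longrightarrow> u \<le> t \<Longrightarrow> f u = g u) \<Longrightarrow> running_inf f t = running_inf g t"
  unfolding running_inf_def by (rule INF_cong) auto

context
  fixes f :: "real \<Rightarrow> real" and T :: real
  assumes cont: "continuous_on {0..T} f"
begin

lemma bdd_below_image_prefix:
  assumes "t \<le> T" shows "bdd_below (f ` {0..t})"
proof -
  have "compact (f ` {0..t})"
    by (intro compact_continuous_image continuous_on_subset[OF cont]) (use assms in auto)
  then show ?thesis
    by (simp add: compact_imp_bounded bounded_imp_bdd_below)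
qed

text \<open>An infimum is determined by its lower bounds, so identities between nested infima become
  exchanges of bounded quantifiers; this equivalence is the translation.\<close>

lemma le_running_inf_iff:
  assumes "0 \<le> t" "t \<le> T"
  shows "c \<le> running_inf f t \<longleftrightarrow> (\<forall>u\<in>{0..t}. c \<le> f u)"
  unfolding running_inf_def
  by (rule le_cINF_iff) (use assms bdd_below_image_prefix in auto)

lemma running_inf_le:
  assumes "0 \<le> u" "u \<le> t" "t \<le> T" shows "running_inf f t \<le> f u"
  using le_running_inf_iff[of t "running_inf f t"] assms by auto

lemma running_inf_antimono:
  assumes "0 \<le> s" "s \<le> t" "t \<le> T" shows "running_inf f t \<le> running_inf f s"
  using assms by (auto simp: le_running_inf_iff[of s] intro!: running_inf_le)

lemma running_inf_attained:
  assumes "0 \<le> t" "t \<le> T"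
  obtains u where "0 \<le> u" "u \<le> t" "running_inf f t = f u"
proof -
  have "continuous_on {0..t} f"
    by (rule continuous_on_subset[OF cont]) (use assms in auto)
  from continuous_attains_inf[OF _ _ this] assms
  obtain u where u: "u \<in> {0..t}" "\<forall>v\<in>{0..t}. f u \<le> f v" by auto
  then have "f u \<le> running_inf f t" using le_running_inf_iff assms by blast
  moreover have "running_inf f t \<le> f u" using running_inf_le u assms by auto
  ultimately show ?thesis using that[of u] u by auto
qed

text \<open>A modulus of uniform continuity of \<open>f\<close> also works for the running infimum:
  a new minimum reached between \<open>s\<close> and \<open>t\<close> stays within \<open>e\<close>
  of \<open>f s\<close>, and \<open>f s\<close> bounds the old infimum from above.\<close>

lemma continuous_on_running_inf: "continuous_on {0..T} (running_inf f)"
proof -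
  have uc: "uniformly_continuous_on {0..T} f"
    using cont by (simp add: compact_uniformly_continuous)
  show ?thesis
    unfolding continuous_on_iff
  proof (intro ballI allI impI)
    fix x e :: real assume x: "x \<in> {0..T}" and e: "e > 0"
    obtain d where d: "d > 0"
      "\<And>s t. s \<in> {0..T} \<Longrightarrow> t \<in> {0..T} \<Longrightarrow> dist t s < d \<Longrightarrow> dist (f t) (f s) < e"
      by (rule uniformly_continuous_onE[OF uc e]) blast
    have *: "\<bar>running_inf f t - running_inf f s\<bar> < e"
      if st: "0 \<le> s" "s \<le> t" "t \<le> T" "t - s < d" for s t
    proof -
      obtain u where u: "0 \<le> u" "u \<le> t" "running_inf f t = f u"
        by (rule running_inf_attained[of t]) (use st in auto)
      have "running_inf f s < f u + e"
      proof (cases "u \<le> s")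
        case True
        then show ?thesis using running_inf_le[of u s] u that e by auto
      next
        case False
        then have "dist (f u) (f s) < e"
          using d(2)[of s u] u that by (auto simp: dist_real_def)
        moreover have "running_inf f s \<le> f s" using running_inf_le that by auto
        ultimately show ?thesis by (auto simp: dist_real_def)
      qed
      moreover have "running_inf f t \<le> running_inf f s" using running_inf_antimono that by auto
      ultimately show ?thesis using u by auto
    qed
    show "\<exists>d>0. \<forall>x'\<in>{0..T}. dist x' x < d \<longrightarrow> dist (running_inf f x') (running_inf f x) < e"
    proof (intro exI conjI ballI impI)
      fix y assume y: "y \<in> {0..T}" "dist y x < d"
      show "dist (running_inf f y) (running_inf f x) < e"
        using *[of x y] *[of y x] x y by (cases "x \<le> y") (auto simp: dist_real_def abs_minus_commute)
    qed (fact d(1))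
  qed
qed

text \<open>If the infimum still drops after \<open>v\<close>, then \<open>f\<close> has to cross
  the level \<open>running_inf f v\<close>; \<open>s\<close> is the first time it gets there, so no
  lower value precedes it.\<close>

lemma running_inf_first_hit:
  assumes "0 \<le> v" "v \<le> t" "t \<le> T" and less: "running_inf f t < running_inf f v"
  obtains s where "v \<le> s" "s \<le> t" "f s = running_inf f v" "running_inf f s = running_inf f v"
proof -
  let ?c = "running_inf f v"
  let ?K = "{v..t} \<inter> f -` {..?c}"
  have ct: "continuous_on {v..t} f"
    by (rule continuous_on_subset[OF cont]) (use assms in auto)
  have "closed ?K"
    by (rule continuous_closed_preimage[OF ct]) auto
  then have "compact ?K"
    by (metis Int_absorb1 compact_Icc compact_Int_closed inf.cobounded1)
  moreover have "?K \<noteq> {}"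
  proof -
    obtain u where u: "0 \<le> u" "u \<le> t" "running_inf f t = f u"
      by (rule running_inf_attained[of t]) (use assms in auto)
    have "v \<le> u"
      using running_inf_le[of u v] u less assms by force
    then show ?thesis using u less by auto
  qed
  ultimately obtain s where s: "s \<in> ?K" and smin: "\<And>r. r \<in> ?K \<Longrightarrow> s \<le> r"
    using compact_attains_inf by metis
  have fs: "f s = ?c"
  proof (rule ccontr)
    assume "f s \<noteq> ?c"
    moreover have "?c \<le> f v" using running_inf_le assms by auto
    moreover have "continuous_on {v..s} f" by (rule continuous_on_subset[OF ct]) (use s in auto)
    ultimately obtain r where "v \<le> r" "r \<le> s" "f r = ?c"
      using IVT2'[of f s ?c v] s by auto
    with smin[of r] s \<open>f s \<noteq> ?c\<close> show False by auto
  qed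
  have "?c \<le> f u" if "0 \<le> u" "u \<le> s" for u
  proof (cases "u \<le> v")
    case True then show ?thesis using running_inf_le that assms by auto
  next
    case False
    then have "u < s \<Longrightarrow> \<not> f u \<le> ?c" using smin[of u] that s by auto
    then show ?thesis using that fs by (cases "u = s") auto
  qed
  then have "?c \<le> running_inf f s" using le_running_inf_iff[of s] assms s by auto
  moreover have "running_inf f s \<le> ?c" using running_inf_antimono assms s by auto
  ultimately have "running_inf f s = ?c" by (rule order.antisym[rotated])
  with s show ?thesis by (intro that[OF _ _ fs]) auto
qed

text \<open>The key to the braid relation: after minimisation over \<open>s\<close>, the Pitman transform of \<open>f\<close>
  can be exchanged for \<open>f\<close> itself.\<close>

lemma pitman_exchange:
  assumes "0 \<le> v" "v \<le> t" "t \<le> T" and w: "0 \<le> w"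
  shows "(\<forall>s\<in>{v..t}. c \<le> w * (f s - 2 * running_inf f s + running_inf f v)) \<longleftrightarrow>
         (\<forall>s\<in>{v..t}. c \<le> w * (f s - running_inf f t))" (is "?L \<longleftrightarrow> ?R")
proof -
  let ?F = "running_inf f"
  have anti: "?F s \<le> ?F v" "?F t \<le> ?F s" "?F s \<le> f s" if "s \<in> {v..t}" for s
    using that assms by (auto intro!: running_inf_antimono running_inf_le)
  show ?thesis
  proof (cases "?F t = ?F v")
    case True
    then have "f s - 2 * ?F s + ?F v = f s - ?F t" if "s \<in> {v..t}" for s
      using anti[OF that] True by linarith
    then show ?thesis by (simp only: cong: ball_cong)
  next
    case False
    then have less: "?F t < ?F v" using anti(1)[of t] assms by auto
    obtain s where s: "v \<le> s" "s \<le> t" "f s = ?F v" "?F s = ?F v"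
      using running_inf_first_hit[OF assms(1-3) less] by blast
    obtain u where u: "0 \<le> u" "u \<le> t" "?F t = f u"
      by (rule running_inf_attained[of t]) (use assms in auto)
    have vu: "v \<le> u" using running_inf_le[of u v] u less assms by force
    \<comment> \<open>Once the infimum drops, both sides just say \<open>c \<le> 0\<close>: the two
      brackets are nonnegative, the left one vanishes at the first hit \<open>s\<close> and the
      right one at the minimiser \<open>u\<close>.\<close>
    have "?L \<longleftrightarrow> c \<le> 0"
    proof
      assume ?L then show "c \<le> 0" using s by force
    next
      assume "c \<le> 0"
      moreover have "0 \<le> w * (f s - 2 * ?F s + ?F v)" if "s \<in> {v..t}" for s
        using anti[OF that] w by (intro mult_nonneg_nonneg) auto
      ultimately show ?L by force
    qed
    moreover have "?R \<longleftrightarrow> c \<le> 0"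
    proof
      assume ?R then show "c \<le> 0" using u vu by force
    next
      assume "c \<le> 0"
      moreover have "0 \<le> w * (f s - ?F t)" if "s \<in> {v..t}" for s
        using anti[OF that] w by (intro mult_nonneg_nonneg) auto
      ultimately show ?R by force
    qed
    ultimately show ?thesis by simp
  qed
qed

end

section \<open>Continuity of linear functionals in finite dimension\<close>

text \<open>The norm of a combination is continuous in its coefficients and attains a positive
  minimum on the compact set where their absolute values sum to 1; homogeneity does the
  rest.\<close>

lemma coordinates_bounded_by_norm:
  fixes B :: "'v::real_normed_vector set"
  assumes "finite B" "independent B"
  obtains \<mu> where "\<mu> > 0" "\<And>c. \<mu> * (\<Sum>b\<in>B. \<bar>c b\<bar>) \<le> norm (\<Sum>b\<in>B. c b *\<^sub>R b)"
proof (cases "B = {}")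
  case True
  then show ?thesis using that[of 1] by auto
next
  case False
  define N where "N c = norm (\<Sum>b\<in>B. c b *\<^sub>R b)" for c :: "'v \<Rightarrow> real"
  \<comment> \<open>Coefficients are functions on the whole type, so compactness comes from
    Tychonoff's theorem for the cube; outside \<open>B\<close> they may take any value in
    it.\<close>
  define K where "K = (PiE UNIV (\<lambda>_. {-1..1})) \<inter> {c :: 'v \<Rightarrow> real. (\<Sum>b\<in>B. \<bar>c b\<bar>) = 1}"
  have coord: "continuous_on UNIV (\<lambda>c :: 'v \<Rightarrow> real. c b)" for b
    by (rule continuous_on_product_coordinates)
  have contN: "continuous_on UNIV N"
    unfolding N_def by (intro continuous_intros coord)
  have "compactin (product_topology (\<lambda>_. euclidean) UNIV) (PiE UNIV (\<lambda>_::'v. {-1..1::real}))"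
    by (simp add: compactin_PiE)
  then have "compact (PiE UNIV (\<lambda>_::'v. {-1..1::real}))"
    by (simp add: euclidean_product_topology)
  moreover have "closed {c :: 'v \<Rightarrow> real. (\<Sum>b\<in>B. \<bar>c b\<bar>) = 1}"
    by (intro closed_Collect_eq continuous_intros coord)
  ultimately have cK: "compact K"
    unfolding K_def by (rule compact_Int_closed)
  obtain b0 where b0: "b0 \<in> B" using False by auto
  have "(\<lambda>b. if b = b0 then 1 else 0) \<in> K"
    using assms b0 unfolding K_def by (auto simp: PiE_def sum.delta' if_distrib cong: if_cong)
  then have neK: "K \<noteq> {}" by auto
  obtain c0 where c0: "c0 \<in> K" and min: "\<And>c. c \<in> K \<Longrightarrow> N c0 \<le> N c"
    using continuous_attains_inf[OF cK neK continuous_on_subset[OF contN]] by auto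
  have pos: "N c0 > 0"
  proof (rule ccontr)
    assume "\<not> N c0 > 0"
    then have "(\<Sum>b\<in>B. c0 b *\<^sub>R b) = 0" by (simp add: N_def)
    then have "\<forall>b\<in>B. c0 b = 0" using assms independentD[of B B c0] by auto
    then show False using c0 by (simp add: K_def)
  qed
  have "N c0 * (\<Sum>b\<in>B. \<bar>c b\<bar>) \<le> N c" for c
  proof -
    define r where "r = (\<Sum>b\<in>B. \<bar>c b\<bar>)"
    have r0: "r \<ge> 0" unfolding r_def by (simp add: sum_nonneg)
    show ?thesis
    proof (cases "r = 0")
      case True
      then show ?thesis by (simp add: r_def N_def)
    next
      case rn: False
      define c' where "c' b = (if b \<in> B then c b / r else 0)" for b
      have s1: "(\<Sum>b\<in>B. \<bar>c' b\<bar>) = 1"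
        using rn r0 by (simp add: c'_def sum_divide_distrib[symmetric] r_def[symmetric])
      have "\<bar>c' b\<bar> \<le> 1" for b
      proof (cases "b \<in> B")
        case True
        then show ?thesis
          using s1 member_le_sum[of b B "\<lambda>b. \<bar>c' b\<bar>"] assms by auto
      qed (simp add: c'_def)
      then have "c' \<in> K" using s1 by (simp add: K_def PiE_def Pi_def abs_le_iff minus_le_iff)
      then have "N c0 \<le> N c'" by (rule min)
      also have "(\<Sum>b\<in>B. c' b *\<^sub>R b) = (1/r) *\<^sub>R (\<Sum>b\<in>B. c b *\<^sub>R b)"
        by (simp add: c'_def scaleR_sum_right divide_inverse mult.commute)
      then have "N c' = N c / r" using r0 by (simp add: N_def)
      finally show ?thesis using rn r0 by (simp add: field_simps r_def[symmetric])
    qed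
  qed
  then show ?thesis using that[of "N c0"] pos by (simp add: N_def)
qed

text \<open>Coroots are only assumed to be linear, while paths are continuous for some arbitrary
  norm; bounding coordinates by that norm closes the gap.\<close>

lemma linear_imp_continuous_on_finite_dim:
  fixes f :: "'v::real_normed_vector \<Rightarrow> real"
  assumes fd: "\<exists>B::'v set. finite B \<and> span B = UNIV" and lin: "linear f"
  shows "continuous_on A f"
proof -
  obtain B0 :: "'v set" where B0: "finite B0" "span B0 = UNIV" using fd by auto
  obtain B where B: "B \<subseteq> B0" "independent B" "B0 \<subseteq> span B"
    using maximal_independent_subset[of B0] by blast
  have finB: "finite B" using B(1) B0(1) by (rule finite_subset)
  have spB: "span B = UNIV"
    using span_mono[OF B(3)] B0(2) by (simp add: span_span top.extremum_unique)
  obtain \<mu> where mu: "\<mu> > 0" "\<And>c. \<mu> * (\<Sum>b\<in>B. \<bar>c b\<bar>) \<le> norm (\<Sum>b\<in>B. c b *\<^sub>R b)"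
    using coordinates_bounded_by_norm finB B(2) by metis
  define M where "M = (\<Sum>b\<in>B. \<bar>f b\<bar>)"
  have M: "\<bar>f b\<bar> \<le> M" if "b \<in> B" for b
    unfolding M_def using that finB member_le_sum[of b B "\<lambda>b. \<bar>f b\<bar>"] by auto
  have "norm (f v) \<le> norm v * (M / \<mu>)" for v
  proof -
    let ?c = "representation B v"
    have v: "v = (\<Sum>b\<in>B. ?c b *\<^sub>R b)"
      using sum_representation_eq[of B v B] B(2) spB finB by auto
    have "f v = f (\<Sum>b\<in>B. ?c b *\<^sub>R b)" using v by metis
    also have "\<dots> = (\<Sum>b\<in>B. ?c b * f b)" using lin by (simp add: linear_sum linear_cmul)
    finally have "\<bar>f v\<bar> \<le> (\<Sum>b\<in>B. \<bar>?c b\<bar> * \<bar>f b\<bar>)"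
      by (metis (no_types, lifting) abs_mult sum_abs sum.cong)
    also have "\<dots> \<le> (\<Sum>b\<in>B. \<bar>?c b\<bar> * M)" by (intro sum_mono mult_left_mono M) auto
    also have "\<dots> = (\<Sum>b\<in>B. \<bar>?c b\<bar>) * M" by (simp add: sum_distrib_right)
    also have "\<dots> \<le> (norm v / \<mu>) * M"
    proof (rule mult_right_mono)
      show "(\<Sum>b\<in>B. \<bar>?c b\<bar>) \<le> norm v / \<mu>"
        using mu(2)[of ?c] mu(1) v by (simp add: field_simps)
      show "0 \<le> M" by (simp add: M_def sum_nonneg)
    qed
    finally show ?thesis by (simp add: field_simps)
  qed
  then have "bounded_linear f"
    using lin unfolding linear_conv_bounded_linear[symmetric] bounded_linear_def bounded_linear_axioms_def by blast
  then show ?thesis by (rule linear_continuous_on)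
qed

section \<open>Pitman transforms and root strings\<close>

text \<open>Root and coroot are arguments here instead of being looked up by an index, so that a
  single root can be studied by itself and later be rescaled.\<close>

definition pitman_along ::
  "real \<Rightarrow> 'v::real_normed_vector \<Rightarrow> ('v \<Rightarrow> real) \<Rightarrow> (real \<Rightarrow> 'v) \<Rightarrow> (real \<Rightarrow> 'v)" where
  "pitman_along T v f \<eta> = (\<lambda>t\<in>{0..T}. \<eta> t - running_inf (\<lambda>u. f (\<eta> u)) t *\<^sub>R v)"

lemma pitman_eq_pitman_along: "pitman sroot coroot T s = pitman_along T (sroot s) (coroot s)"
  by (rule ext) (simp add: pitman_def pitman_along_def running_inf_def)

lemma pathsD:
  assumes "\<eta> \<in> paths T"
  shows "continuous_on {0..T} \<eta>" "\<eta> 0 = 0" "\<eta> \<in> extensional {0..T}"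
  using assms by (auto simp: paths_def)

lemma paths_eqI:
  assumes "\<eta> \<in> paths T" "\<xi> \<in> paths T" "\<And>t. 0 \<le> t \<Longrightarrow> t \<le> T \<Longrightarrow> \<eta> t = \<xi> t"
  shows "\<eta> = \<xi>"
  using assms by (intro extensionalityI[of _ "{0..T}"]) (auto dest: pathsD)

locale root_direction =
  fixes T :: real and v :: "'v::real_normed_vector" and f :: "'v \<Rightarrow> real"
  assumes T_nonneg: "0 \<le> T"
    and linear_coroot: "linear f"
    and continuous_coroot: "continuous_on UNIV f"
    and coroot_self: "f v = 2"
begin

abbreviation pit :: "(real \<Rightarrow> 'v) \<Rightarrow> (real \<Rightarrow> 'v)" where
  "pit \<equiv> pitman_along T v f"

abbreviation inf_coroot :: "(real \<Rightarrow> 'v) \<Rightarrow> real \<Rightarrow> real" where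
  "inf_coroot \<eta> \<equiv> running_inf (\<lambda>u. f (\<eta> u))"

lemma coroot_simps: "f (x + y) = f x + f y" "f (x - y) = f x - f y" "f (c *\<^sub>R x) = c * f x" "f 0 = 0"
  using linear_coroot by (auto simp: linear_add linear_diff linear_cmul linear_0)

lemma continuous_coroot_path: "\<eta> \<in> paths T \<Longrightarrow> continuous_on {0..T} (\<lambda>t. f (\<eta> t))"
  using continuous_on_compose2[OF continuous_coroot pathsD(1)] by auto

lemma inf_coroot_0: "\<eta> \<in> paths T \<Longrightarrow> inf_coroot \<eta> 0 = 0"
  using pathsD(2)[of \<eta> T] coroot_simps(4) by (simp add: running_inf_def)

lemma inf_coroot_le:
  "\<eta> \<in> paths T \<Longrightarrow> 0 \<le> u \<Longrightarrow> u \<le> t \<Longrightarrow> t \<le> T \<Longrightarrow> inf_coroot \<eta> t \<le> f (\<eta> u)"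
  using running_inf_le[OF continuous_coroot_path] by blast

lemma inf_coroot_antimono:
  "\<eta> \<in> paths T \<Longrightarrow> 0 \<le> s \<Longrightarrow> s \<le> t \<Longrightarrow> t \<le> T \<Longrightarrow> inf_coroot \<eta> t \<le> inf_coroot \<eta> s"
  using running_inf_antimono[OF continuous_coroot_path] by blast

lemma inf_coroot_nonpos: "\<eta> \<in> paths T \<Longrightarrow> 0 \<le> t \<Longrightarrow> t \<le> T \<Longrightarrow> inf_coroot \<eta> t \<le> 0"
  using inf_coroot_antimono[of \<eta> 0 t] inf_coroot_0 by auto

lemma inf_coroot_eq_0:
  assumes "\<eta> \<in> paths T" "\<And>t. 0 \<le> t \<Longrightarrow> t \<le> T \<Longrightarrow> 0 \<le> f (\<eta> t)" "0 \<le> t" "t \<le> T"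
  shows "inf_coroot \<eta> t = 0"
  using le_running_inf_iff[OF continuous_coroot_path, of \<eta> t 0] inf_coroot_nonpos[of \<eta> t] assms
  by (intro order.antisym) auto

lemma pit_apply: "0 \<le> t \<Longrightarrow> t \<le> T \<Longrightarrow> pit \<eta> t = \<eta> t - inf_coroot \<eta> t *\<^sub>R v"
  by (simp add: pitman_along_def)

lemma coroot_pit: "0 \<le> t \<Longrightarrow> t \<le> T \<Longrightarrow> f (pit \<eta> t) = f (\<eta> t) - 2 * inf_coroot \<eta> t"
  by (simp add: pit_apply coroot_simps coroot_self)

lemma pit_paths: "\<eta> \<in> paths T \<Longrightarrow> pit \<eta> \<in> paths T"
proof -
  assume \<eta>: "\<eta> \<in> paths T"
  have "continuous_on {0..T} (\<lambda>t. \<eta> t - inf_coroot \<eta> t *\<^sub>R v)"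
    using \<eta> by (intro continuous_intros continuous_on_running_inf continuous_coroot_path pathsD)
  then have "continuous_on {0..T} (pit \<eta>)"
    by (rule continuous_on_eq) (simp add: pit_apply)
  then show ?thesis
    using \<eta> T_nonneg by (auto simp: paths_def pitman_along_def inf_coroot_0)
qed

lemma coroot_pit_nonneg:
  "\<eta> \<in> paths T \<Longrightarrow> 0 \<le> t \<Longrightarrow> t \<le> T \<Longrightarrow> 0 \<le> f (pit \<eta> t)"
  using inf_coroot_le[of \<eta> t t] inf_coroot_nonpos[of \<eta> t] by (simp add: coroot_pit)

lemma pit_eq_self:
  assumes "\<eta> \<in> paths T" "\<And>t. 0 \<le> t \<Longrightarrow> t \<le> T \<Longrightarrow> 0 \<le> f (\<eta> t)"
  shows "pit \<eta> = \<eta>"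
  using assms inf_coroot_eq_0[of \<eta>] by (intro paths_eqI) (auto simp: pit_apply pit_paths)

lemma pit_idem: "\<eta> \<in> paths T \<Longrightarrow> pit (pit \<eta>) = pit \<eta>"
  by (intro pit_eq_self pit_paths coroot_pit_nonneg)

section \<open>Strings of paths with a common Pitman transform\<close>

lemma root_nonzero: "v \<noteq> 0"
  using coroot_self coroot_simps(4) by auto

text \<open>The two infima agree at \<open>T\<close>. If that of \<open>\<xi>\<close> were lower at
  \<open>t\<close>, that of \<open>\<eta>\<close> would drop after \<open>t\<close>. At its first
  hit \<open>s\<close> the coroot of \<open>pit \<eta>\<close> is
  \<open>- inf_coroot \<eta> t\<close>, whereas that of \<open>pit \<xi>\<close> is at least
  \<open>- inf_coroot \<xi> t\<close>, which is larger.\<close>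

lemma inf_coroot_le_of_pit_eq:
  assumes \<eta>: "\<eta> \<in> paths T" and \<xi>: "\<xi> \<in> paths T" and eq: "pit \<xi> = pit \<eta>" "\<xi> T = \<eta> T"
    and t: "0 \<le> t" "t \<le> T"
  shows "inf_coroot \<eta> t \<le> inf_coroot \<xi> t"
proof (rule ccontr)
  assume "\<not> ?thesis"
  then have less: "inf_coroot \<xi> t < inf_coroot \<eta> t" by simp
  have "inf_coroot \<xi> T = inf_coroot \<eta> T"
    using fun_cong[OF eq(1), of T] eq(2) T_nonneg root_nonzero by (simp add: pit_apply)
  then have "inf_coroot \<eta> T < inf_coroot \<eta> t"
    using inf_coroot_antimono[OF \<xi> t] less by simp
  then obtain s where s: "t \<le> s" "s \<le> T" "f (\<eta> s) = inf_coroot \<eta> t" "inf_coroot \<eta> s = inf_coroot \<eta> t"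
    using running_inf_first_hit[OF continuous_coroot_path[OF \<eta>], of t T] t by blast
  have "f (pit \<xi> s) = f (pit \<eta> s)" by (simp add: eq)
  then have "f (\<xi> s) - 2 * inf_coroot \<xi> s = f (\<eta> s) - 2 * inf_coroot \<eta> s"
    using s t by (simp only: coroot_pit)
  moreover have "inf_coroot \<xi> s \<le> f (\<xi> s)" "inf_coroot \<xi> s \<le> inf_coroot \<xi> t"
    using inf_coroot_le[OF \<xi>, of s s] inf_coroot_antimono[OF \<xi>, of t s] s t by auto
  ultimately show False using s(3,4) less by linarith
qed

lemma pit_string_unique:
  assumes \<eta>: "\<eta> \<in> paths T" and \<xi>: "\<xi> \<in> paths T" and eq: "pit \<xi> = pit \<eta>" "\<xi> T = \<eta> T"
  shows "\<xi> = \<eta>"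
proof (rule paths_eqI[OF \<xi> \<eta>])
  fix t assume t: "0 \<le> t" "t \<le> T"
  have "inf_coroot \<eta> t = inf_coroot \<xi> t"
    using inf_coroot_le_of_pit_eq[OF \<eta> \<xi> eq t] inf_coroot_le_of_pit_eq[OF \<xi> \<eta> eq[symmetric] t]
    by (rule order.antisym)
  then show "\<xi> t = \<eta> t" using fun_cong[OF eq(1), of t] t by (simp add: pit_apply)
qed

text \<open>The inverse is \<open>\<xi> t = \<pi> t - min x (inf\<^bsub>t \<le> u \<le> T\<^esub> f (\<pi> u)) v\<close>.\<close>

lemma pit_string_exists:
  assumes \<pi>: "\<pi> \<in> paths T" and pos: "\<And>t. 0 \<le> t \<Longrightarrow> t \<le> T \<Longrightarrow> 0 \<le> f (\<pi> t)"
    and x: "0 \<le> x" "x \<le> f (\<pi> T)"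
  obtains \<xi> where "\<xi> \<in> paths T" "pit \<xi> = \<pi>" "\<xi> T = \<pi> T - x *\<^sub>R v"
proof -
  define g where "g u = f (\<pi> u)" for u
  \<comment> \<open>The infimum over the future \<open>{t..T}\<close>, written as a running infimum
    of the time-reversed function.\<close>
  define J where "J t = running_inf (\<lambda>u. g (T - u)) (T - t)" for t
  define K where "K t = min x (J t)" for t
  define \<xi> where "\<xi> = (\<lambda>t\<in>{0..T}. \<pi> t - K t *\<^sub>R v)"
  have contg: "continuous_on {0..T} g"
    unfolding g_def by (rule continuous_coroot_path[OF \<pi>])
  have contr: "continuous_on {0..T} (\<lambda>u. g (T - u))"
    by (rule continuous_on_compose2[OF contg]) (auto intro!: continuous_intros)
  have le_J: "c \<le> J t \<longleftrightarrow> (\<forall>u\<in>{t..T}. c \<le> g u)" if "0 \<le> t" "t \<le> T" for c t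
  proof -
    have "(\<forall>u\<in>{0..T-t}. c \<le> g (T - u)) \<longleftrightarrow> (\<forall>u\<in>{t..T}. c \<le> g u)"
    proof (intro iffI ballI)
      fix u assume "\<forall>u\<in>{0..T-t}. c \<le> g (T - u)" "u \<in> {t..T}"
      then show "c \<le> g u" by (auto dest: bspec[of _ _ "T - u"])
    qed auto
    then show ?thesis unfolding J_def using le_running_inf_iff[OF contr, of "T - t" c] that by simp
  qed
  have le_K: "c \<le> K t \<longleftrightarrow> c \<le> x \<and> (\<forall>u\<in>{t..T}. c \<le> g u)" if "0 \<le> t" "t \<le> T" for c t
    unfolding K_def using le_J[OF that] by auto
  have K_le: "K t \<le> x" "\<And>u. t \<le> u \<Longrightarrow> u \<le> T \<Longrightarrow> K t \<le> g u" if "0 \<le> t" "t \<le> T" for t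
    using le_K[OF that, of "K t"] by auto
  have K_mono: "K s \<le> K t" if "0 \<le> s" "s \<le> t" "t \<le> T" for s t
    using le_K[of t "K s"] K_le[of s] that by auto
  have contK: "continuous_on {0..T} K"
    unfolding K_def J_def
    by (intro continuous_intros continuous_on_compose2[OF continuous_on_running_inf[OF contr]]) auto
  have g0: "g 0 = 0" unfolding g_def using pathsD(2)[OF \<pi>] coroot_simps(4) by simp
  have K0: "K 0 = 0"
    using K_le(2)[of 0 0] le_K[of 0 0] T_nonneg x pos g0 by (auto simp: g_def intro!: order.antisym)
  have KT: "K T = x"
    using K_le(1)[of T] le_K[of T x] T_nonneg x by (auto simp: g_def intro!: order.antisym)
  have \<xi>_apply: "\<xi> t = \<pi> t - K t *\<^sub>R v" if "0 \<le> t" "t \<le> T" for t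
    using that by (simp add: \<xi>_def)
  have f\<xi>: "f (\<xi> t) = g t - 2 * K t" if "0 \<le> t" "t \<le> T" for t
    using \<xi>_apply[OF that] by (simp add: coroot_simps coroot_self g_def)
  have "continuous_on {0..T} (\<lambda>t. \<pi> t - K t *\<^sub>R v)"
    by (intro continuous_intros contK pathsD(1)[OF \<pi>])
  then have "continuous_on {0..T} \<xi>"
    by (rule continuous_on_eq) (simp add: \<xi>_apply)
  then have \<xi>: "\<xi> \<in> paths T"
    using T_nonneg K0 pathsD(2)[OF \<pi>] by (auto simp: paths_def \<xi>_def)
  have inf\<xi>: "inf_coroot \<xi> t = - K t" if t: "0 \<le> t" "t \<le> T" for t
  proof (rule order.antisym)
    show "- K t \<le> inf_coroot \<xi> t"
      unfolding le_running_inf_iff[OF continuous_coroot_path[OF \<xi>] t]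
    proof
      fix u assume u: "u \<in> {0..t}"
      then have "K u \<le> g u" "K u \<le> K t" using K_le(2)[of u u] K_mono[of u t] t by auto
      then show "- K t \<le> f (\<xi> u)" using f\<xi>[of u] u t by auto
    qed
    \<comment> \<open>To reach the value \<open>- K t\<close>, let \<open>u\<close> be the last time
      in \<open>{0..t}\<close> with \<open>g u \<le> K t\<close>. From \<open>u\<close> on
      \<open>g\<close> is at least \<open>K t\<close>, so \<open>K u\<close> is no smaller than
      \<open>K t\<close>, and \<open>f (\<xi> u) = g u - 2 * K u\<close> is at most
      \<open>- K t\<close>.\<close>
    let ?A = "{0..t} \<inter> g -` {..K t}"
    have "closed ?A"
      by (rule continuous_closed_preimage) (use t in \<open>auto intro: continuous_on_subset[OF contg]\<close>)
    then have "compact ({0..t} \<inter> ?A)" by (intro compact_Int_closed) auto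
    then have "compact ?A" by (simp add: Int_absorb1)
    moreover have "0 \<in> ?A"
      using t g0 K_mono[of 0 t] K0 by auto
    ultimately have "\<exists>u\<in>?A. \<forall>r\<in>?A. r \<le> u"
      by (intro compact_attains_sup) auto
    then obtain u where u: "u \<in> ?A" and umax: "\<And>r. r \<in> ?A \<Longrightarrow> r \<le> u"
      by blast
    have "K t \<le> g r" if r: "r \<in> {u..t}" for r
    proof (cases "r = u")
      case True
      show ?thesis
      proof (rule ccontr)
        assume neg: "\<not> K t \<le> g r"
        have "K t \<le> g t" using K_le(2)[of t t] t by auto
        moreover have "continuous_on {u..t} g"
          by (rule continuous_on_subset[OF contg]) (use u t in auto)
        ultimately obtain r' where "u \<le> r'" "r' \<le> t" "g r' = K t"
          using IVT'[of g u "K t" t] neg True u by auto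
        then show False using umax[of r'] u neg True by auto
      qed
    next
      case False
      then have "r \<notin> ?A" using umax[of r] r by auto
      then show ?thesis using r u by auto
    qed
    then have "K t \<le> g r" if "r \<in> {u..T}" for r
      using K_le(2)[OF t, of r] that by (cases "r \<le> t") auto
    then have "K t \<le> K u"
      using le_K[of u "K t"] K_le(1)[OF t] u t by auto
    then have "f (\<xi> u) \<le> - K t"
      using f\<xi>[of u] u t by auto
    then show "inf_coroot \<xi> t \<le> - K t"
      using inf_coroot_le[OF \<xi>, of u t] u t by auto
  qed
  have "pit \<xi> = \<pi>"
    by (rule paths_eqI[OF pit_paths[OF \<xi>] \<pi>]) (simp add: pit_apply inf\<xi> \<xi>_apply)
  then show ?thesis
    using that[OF \<xi>] \<xi>_apply[of T] KT T_nonneg by auto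
qed

lemma inf_coroot_of_string:
  assumes "pit \<xi> = pit \<eta>" "\<xi> T = \<eta> T + x *\<^sub>R v"
  shows "inf_coroot \<xi> T = inf_coroot \<eta> T + x"
proof -
  have "(inf_coroot \<eta> T + x) *\<^sub>R v = inf_coroot \<xi> T *\<^sub>R v"
    using fun_cong[OF assms(1), of T] assms(2) T_nonneg by (simp add: pit_apply algebra_simps)
  then show ?thesis using root_nonzero by simp
qed

text \<open>The bounds are those in the definition of \<open>path_e\<close>. They are necessary
  because an infimum is at most the values at the times 0 and \<open>T\<close>, and sufficient by
  lowering \<open>pit \<eta>\<close>.\<close>

lemma string_exists_iff:
  assumes \<eta>: "\<eta> \<in> paths T"
  shows "(\<exists>\<xi>\<in>paths T. pit \<xi> = pit \<eta> \<and> \<xi> T = \<eta> T + x *\<^sub>R v) \<longleftrightarrow>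
    inf_coroot \<eta> T - f (\<eta> T) \<le> x \<and> x \<le> - inf_coroot \<eta> T" (is "?L \<longleftrightarrow> ?R")
proof
  assume ?L
  then obtain \<xi> where \<xi>: "\<xi> \<in> paths T" and eq: "pit \<xi> = pit \<eta>" "\<xi> T = \<eta> T + x *\<^sub>R v" by auto
  have "inf_coroot \<xi> T \<le> 0" "inf_coroot \<xi> T \<le> f (\<xi> T)"
    using \<xi> T_nonneg by (auto intro: inf_coroot_nonpos inf_coroot_le)
  moreover have "f (\<xi> T) = f (\<eta> T) + 2 * x"
    by (simp add: eq coroot_simps coroot_self)
  ultimately show ?R using inf_coroot_of_string[OF eq] by auto
next
  assume R: ?R
  have T: "pit \<eta> T = \<eta> T - inf_coroot \<eta> T *\<^sub>R v" "f (pit \<eta> T) = f (\<eta> T) - 2 * inf_coroot \<eta> T"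
    using T_nonneg pit_apply[of T] coroot_pit[of T] by auto
  \<comment> \<open>The infimum at \<open>T\<close> has to become
    \<open>inf_coroot \<eta> T + x\<close>; the transform has infimum 0, so it is lowered by the
    negative of this number.\<close>
  obtain \<xi> where "\<xi> \<in> paths T" "pit \<xi> = pit \<eta>" "\<xi> T = pit \<eta> T - (- inf_coroot \<eta> T - x) *\<^sub>R v"
    by (rule pit_string_exists[OF pit_paths[OF \<eta>] coroot_pit_nonneg[OF \<eta>], of "- inf_coroot \<eta> T - x"])
      (use R T(2) in auto)
  then show ?L using T(1) by (intro bexI[of _ \<xi>]) (auto simp: algebra_simps)
qed

end

section \<open>Alternating products of Pitman transforms\<close>

lemma le_all_eqI: "(\<And>x::real. x \<le> a \<longleftrightarrow> x \<le> b) \<Longrightarrow> a = b"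
  by (meson order.antisym order.refl)

lemma running_inf_scale:
  assumes "continuous_on {0..T} f" "0 \<le> w" "0 \<le> t" "t \<le> T"
  shows "running_inf (\<lambda>s. w * f s) t = w * running_inf f t"
proof (cases "w = 0")
  case True
  then show ?thesis using assms by (simp add: running_inf_def)
next
  case False
  then have w: "w > 0" using assms by simp
  have c: "continuous_on {0..T} (\<lambda>s. w * f s)" by (intro continuous_intros assms)
  show ?thesis
  proof (rule le_all_eqI)
    fix x
    have "x \<le> w * r \<longleftrightarrow> x / w \<le> r" for r using w by (simp add: field_simps)
    then show "x \<le> running_inf (\<lambda>s. w * f s) t \<longleftrightarrow> x \<le> w * running_inf f t"
      by (simp add: le_running_inf_iff[OF c assms(3,4)] le_running_inf_iff[OF assms(1,3,4)])
  qed
qed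

text \<open>Both sides unfold into quantifiers over \<open>v \<le> s\<close> in
  \<open>{0..t}\<close>. With \<open>v\<close> fixed, \<open>pitman_exchange\<close> treats all
  \<open>s\<close> at once, and the quantifiers are swapped back. The function \<open>q\<close>
  stands for the remaining terms of a nested infimum.\<close>

lemma double_running_inf_exchange:
  assumes c: "continuous_on {0..T} c" and q: "continuous_on {0..T} q" and w: "0 \<le> w"
    and t: "0 \<le> t" "t \<le> T"
  shows "running_inf (\<lambda>s. w * (c s - 2 * running_inf c s) +
           running_inf (\<lambda>v. w * running_inf c v + q v) s) t =
         running_inf (\<lambda>s. w * c s + running_inf q s) t - w * running_inf c t"
    (is "running_inf ?l t = running_inf ?r t - _")
proof (rule le_all_eqI)
  fix x
  let ?F = "running_inf c"
  have F: "continuous_on {0..T} ?F" by (rule continuous_on_running_inf[OF c])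
  have q': "continuous_on {0..T} (\<lambda>v. w * ?F v + q v)" by (intro continuous_intros F q)
  have l: "continuous_on {0..T} ?l"
    by (intro continuous_intros c F continuous_on_running_inf q')
  have r: "continuous_on {0..T} ?r"
    by (intro continuous_intros c continuous_on_running_inf q)
  have "x \<le> running_inf ?l t \<longleftrightarrow>
      (\<forall>s\<in>{0..t}. x - w * (c s - 2 * ?F s) \<le> running_inf (\<lambda>v. w * ?F v + q v) s)"
    unfolding le_running_inf_iff[OF l t] by (intro ball_cong refl) auto
  also have "\<dots> \<longleftrightarrow> (\<forall>s\<in>{0..t}. \<forall>v\<in>{0..s}. x - w * (c s - 2 * ?F s) \<le> w * ?F v + q v)"
    using t by (intro ball_cong refl le_running_inf_iff[OF q']) auto
  also have "\<dots> \<longleftrightarrow> (\<forall>v\<in>{0..t}. \<forall>s\<in>{v..t}. x - q v \<le> w * (c s - 2 * ?F s + ?F v))"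
    by (force simp: algebra_simps)
  also have "\<dots> \<longleftrightarrow> (\<forall>v\<in>{0..t}. \<forall>s\<in>{v..t}. x - q v \<le> w * (c s - ?F t))"
    using t w by (intro ball_cong refl pitman_exchange[OF c]) auto
  also have "\<dots> \<longleftrightarrow> (\<forall>s\<in>{0..t}. \<forall>v\<in>{0..s}. x + w * ?F t - w * c s \<le> q v)"
    by (force simp: algebra_simps)
  also have "\<dots> \<longleftrightarrow> (\<forall>s\<in>{0..t}. x + w * ?F t - w * c s \<le> running_inf q s)"
    using t by (intro ball_cong refl le_running_inf_iff[OF q, symmetric]) auto
  also have "\<dots> \<longleftrightarrow> x + w * ?F t \<le> running_inf ?r t"
    unfolding le_running_inf_iff[OF r t] by (intro ball_cong refl) auto
  finally show "x \<le> running_inf ?l t \<longleftrightarrow> x \<le> running_inf ?r t - w * ?F t" by auto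
qed

text \<open>\<open>nested_inf h j i t\<close> is the infimum of \<open>h i s\<^sub>0 + h (i+1) s\<^sub>1 + \<dots> + h (i+j-1) s\<^bsub>j-1\<^esub>\<close> over
  \<open>t \<ge> s\<^sub>0 \<ge> \<dots> \<ge> s\<^bsub>j-1\<^esub> \<ge> 0\<close>.\<close>

primrec nested_inf :: "(nat \<Rightarrow> real \<Rightarrow> real) \<Rightarrow> nat \<Rightarrow> nat \<Rightarrow> real \<Rightarrow> real" where
  "nested_inf h 0 = (\<lambda>i t. 0)"
| "nested_inf h (Suc j) = (\<lambda>i t. running_inf (\<lambda>s. h i s + nested_inf h j (Suc i) s) t)"

lemma continuous_on_nested_inf:
  assumes "\<And>i. continuous_on {0..T} (h i)"
  shows "continuous_on {0..T} (nested_inf h j i)"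
proof (induction j arbitrary: i)
  case (Suc j)
  show ?case
    by (simp, rule continuous_on_running_inf, intro continuous_intros assms Suc)
qed simp

lemma nested_inf_cong:
  assumes "\<And>i s. 0 \<le> s \<Longrightarrow> s \<le> T \<Longrightarrow> h i s = h' i s" "0 \<le> t" "t \<le> T"
  shows "nested_inf h j i t = nested_inf h' j i t"
  using assms(2,3)
proof (induction j arbitrary: i t)
  case (Suc j)
  then show ?case by (simp, intro running_inf_cong) (simp add: assms(1))
qed simp

lemma nested_inf_drop_last:
  assumes "\<And>s. h (i + j) s = 0" "0 \<le> t"
  shows "nested_inf h (Suc j) i t = nested_inf h j i t"
  using assms
proof (induction j arbitrary: i t)
  case 0
  then show ?case by (simp add: running_inf_def)
next
  case (Suc j)
  have "running_inf (\<lambda>s. h i s + nested_inf h (Suc j) (Suc i) s) t =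
      running_inf (\<lambda>s. h i s + nested_inf h j (Suc i) s) t"
    using Suc.IH[of "Suc i"] Suc.prems by (intro running_inf_cong arg_cong2[where f = "(+)"] refl) auto
  then show ?case by (simp only: nested_inf.simps)
qed

context
  fixes T k :: real and c d :: "real \<Rightarrow> real" and w :: "nat \<Rightarrow> real" and N :: nat
  assumes c: "continuous_on {0..T} c" and d: "continuous_on {0..T} d"
    and w_nonneg: "\<And>i. i \<le> N \<Longrightarrow> 0 \<le> w i"
    and w_rec: "\<And>i. w i + w (Suc (Suc i)) = k * w (Suc i)"
begin

private abbreviation "F \<equiv> running_inf c"
private abbreviation "h \<equiv> \<lambda>i s. w i * (if even (N + i) then c s else d s)"
text \<open>What \<open>h\<close> becomes when the path is transformed along the root belonging to
  \<open>c\<close>, on which \<open>c\<close> takes the value 2 and \<open>d\<close> the value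
  \<open>- k\<close>. Parity is counted from \<open>N\<close>, so that the last of the terms 1 to
  \<open>N\<close> carries \<open>c\<close>, the coroot of the innermost transform.\<close>

private abbreviation "h' \<equiv> \<lambda>i s. w i * (if even (N + i) then c s - 2 * F s else d s + k * F s)"

private lemma cont_h: "continuous_on {0..T} (nested_inf h j i)"
proof (rule continuous_on_nested_inf)
  fix i show "continuous_on {0..T} (h i)"
    by (cases "even (N + i)") (simp_all add: c d continuous_on_mult_left)
qed

text \<open>Induction from the last index downwards, between two shapes. If \<open>j\<close> is
  even, the first index carries \<open>c\<close>, and \<open>double_running_inf_exchange\<close>
  trades the transform for the correction \<open>- w (Suc i) * F t\<close>. If \<open>j\<close> is
  odd, it carries \<open>d\<close>, whose \<open>k * F\<close> joins the correction from behind to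
  \<open>w i * F\<close> by the recurrence; this is the form that the next exchange needs.\<close>

lemma nested_inf_transformed:
  assumes "Suc i + j = N" "0 \<le> t" "t \<le> T"
  shows "nested_inf h' j (Suc i) t =
    (if even j then nested_inf h (Suc j) (Suc i) t - w (Suc i) * F t
     else running_inf (\<lambda>s. w (Suc i) * d s + w i * F s + nested_inf h j (Suc (Suc i)) s) t)"
  using assms
proof (induction j arbitrary: i t)
  case 0
  then show ?case using running_inf_scale[OF c w_nonneg[of N], of t] by auto
next
  case (Suc j)
  show ?case
  proof (cases "even j")
    case True
    have odd: "odd (N + Suc i)" using Suc.prems(1) True by presburger
    have "nested_inf h' (Suc j) (Suc i) t =
      running_inf (\<lambda>s. h' (Suc i) s + nested_inf h' j (Suc (Suc i)) s) t" by simp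
    also have "\<dots> = running_inf (\<lambda>s. w (Suc i) * d s + w i * F s + nested_inf h (Suc j) (Suc (Suc i)) s) t"
    proof (rule running_inf_cong)
      fix s assume s: "0 \<le> s" "s \<le> t"
      have "nested_inf h' j (Suc (Suc i)) s = nested_inf h (Suc j) (Suc (Suc i)) s - w (Suc (Suc i)) * F s"
        using Suc.IH[of "Suc i" s] Suc.prems s True by simp
      moreover have "h' (Suc i) s = w (Suc i) * d s + (w i + w (Suc (Suc i))) * F s"
        using odd by (simp add: w_rec algebra_simps)
      ultimately show "h' (Suc i) s + nested_inf h' j (Suc (Suc i)) s =
          w (Suc i) * d s + w i * F s + nested_inf h (Suc j) (Suc (Suc i)) s"
        by (simp only: algebra_simps)
    qed
    finally show ?thesis using True by simp
  next
    case False
    have even: "even (N + Suc i)" using Suc.prems(1) False by presburger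
    define q where "q v = w (Suc (Suc i)) * d v + nested_inf h j (Suc (Suc (Suc i))) v" for v
    have q: "continuous_on {0..T} q"
      unfolding q_def by (intro continuous_intros d cont_h)
    have "nested_inf h' (Suc j) (Suc i) t =
      running_inf (\<lambda>s. h' (Suc i) s + nested_inf h' j (Suc (Suc i)) s) t" by simp
    also have "\<dots> = running_inf (\<lambda>s. w (Suc i) * (c s - 2 * F s) +
        running_inf (\<lambda>v. w (Suc i) * F v + q v) s) t"
    proof (rule running_inf_cong)
      fix s assume s: "0 \<le> s" "s \<le> t"
      have "nested_inf h' j (Suc (Suc i)) s = running_inf (\<lambda>v. w (Suc i) * F v + q v) s"
        using Suc.IH[of "Suc i" s] Suc.prems s False by (simp add: q_def algebra_simps)
      then show "h' (Suc i) s + nested_inf h' j (Suc (Suc i)) s =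
          w (Suc i) * (c s - 2 * F s) + running_inf (\<lambda>v. w (Suc i) * F v + q v) s"
        using even by simp
    qed
    also have "\<dots> = running_inf (\<lambda>s. w (Suc i) * c s + running_inf q s) t - w (Suc i) * F t"
      using Suc.prems by (intro double_running_inf_exchange[OF c q] w_nonneg) auto
    also have "running_inf (\<lambda>s. w (Suc i) * c s + running_inf q s) t = nested_inf h (Suc (Suc j)) (Suc i) t"
      using even by (simp add: q_def[abs_def])
    finally show ?thesis using False by simp
  qed
qed

text \<open>The initial weights serve this purpose: \<open>w 0 = 0\<close> removes the leftover
  inside the infimum, and \<open>w (Suc 0) = 1\<close> makes the correction equal to the infimum
  that the transform subtracts.\<close>

lemma nested_inf_transformed_from_1:
  assumes "N = Suc n" "w 0 = 0" "w (Suc 0) = 1" "0 \<le> t" "t \<le> T"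
  shows "nested_inf h' n (Suc 0) t + (if even n then F t else 0) = nested_inf h N (Suc 0) t"
  using nested_inf_transformed[of 0 n t] assms by (cases "even n") auto

end

section \<open>Alternating words and Chebyshev weights\<close>

fun alternating :: "'a \<Rightarrow> 'a \<Rightarrow> nat \<Rightarrow> 'a list" where
  "alternating a b 0 = []"
| "alternating a b (Suc n) = a # alternating b a n"

lemma alternating_snoc: "alternating a b (Suc n) = alternating a b n @ [if even n then a else b]"
  by (induction n arbitrary: a b) auto

lemma set_alternating: "set (alternating a b n) \<subseteq> {a, b}"
  by (induction n arbitrary: a b) auto

lemma length_alternating [simp]: "length (alternating a b n) = n"
  by (induction n arbitrary: a b) auto

text \<open>\<open>chebyshev_U (2 cos \<theta>) n = sin (n \<theta>) / sin \<theta>\<close>: the Chebyshev polynomials of the second kind,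
  with the index shifted by one.\<close>

fun chebyshev_U :: "real \<Rightarrow> nat \<Rightarrow> real" where
  "chebyshev_U k 0 = 0"
| "chebyshev_U k (Suc 0) = 1"
| "chebyshev_U k (Suc (Suc n)) = k * chebyshev_U k (Suc n) - chebyshev_U k n"

lemma chebyshev_U_cos: "sin \<theta> * chebyshev_U (2 * cos \<theta>) n = sin (real n * \<theta>)"
proof (induction "2 * cos \<theta>" n rule: chebyshev_U.induct)
  case (3 n)
  have "sin (real (Suc (Suc n)) * \<theta>) = 2 * cos \<theta> * sin (real (Suc n) * \<theta>) - sin (real n * \<theta>)"
  proof -
    have "real (Suc (Suc n)) * \<theta> = real (Suc n) * \<theta> + \<theta>" "real n * \<theta> = real (Suc n) * \<theta> - \<theta>"
      by (simp_all add: algebra_simps)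
    then show ?thesis by (simp only: sin_add sin_diff) (simp add: algebra_simps)
  qed
  then show ?case using 3 by (simp add: algebra_simps)
qed auto

text \<open>The sine is nonnegative on multiples of pi/m up to pi and vanishes at pi. The braid
  relation needs just these two facts about the angle.\<close>

lemma chebyshev_U_dihedral:
  assumes "2 \<le> m"
  shows "i \<le> m \<Longrightarrow> 0 \<le> chebyshev_U (2 * cos (pi / real m)) i"
    and "chebyshev_U (2 * cos (pi / real m)) m = 0"
proof -
  let ?\<theta> = "pi / real m"
  have pos: "sin ?\<theta> > 0" using assms by (intro sin_gt_zero) (auto simp: field_simps)
  have m: "real m * ?\<theta> = pi" using assms by simp
  then show "chebyshev_U (2 * cos ?\<theta>) m = 0"
    using chebyshev_U_cos[of ?\<theta> m] pos by auto
  assume "i \<le> m"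
  then have "real i * ?\<theta> \<le> real m * ?\<theta>" by (intro mult_right_mono) auto
  then have "0 \<le> sin (real i * ?\<theta>)" using m by (intro sin_ge_zero) auto
  then show "0 \<le> chebyshev_U (2 * cos ?\<theta>) i"
    using chebyshev_U_cos[of ?\<theta> i] pos by (metis zero_le_mult_iff not_less)
qed

section \<open>The rank two formula for a symmetric pairing\<close>

locale normalized_root_pair =
  a: root_direction T "sroot a" "coroot a" + b: root_direction T "sroot b" "coroot b"
  for T and sroot :: "'i \<Rightarrow> 'v::real_normed_vector" and coroot :: "'i \<Rightarrow> 'v \<Rightarrow> real" and a b +
  fixes k :: real
  assumes pairing: "coroot a (sroot b) = - k" "coroot b (sroot a) = - k"
begin

definition alternating_inf :: "(real \<Rightarrow> 'v) \<Rightarrow> nat \<Rightarrow> real \<Rightarrow> real" where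
  "alternating_inf X n = nested_inf (\<lambda>i s. chebyshev_U k i * coroot (if odd i then a else b) (X s)) n (Suc 0)"

lemma alternating_inf_drop_last:
  "chebyshev_U k (Suc n) = 0 \<Longrightarrow> 0 \<le> t \<Longrightarrow> alternating_inf X (Suc n) t = alternating_inf X n t"
  unfolding alternating_inf_def by (rule nested_inf_drop_last) auto

end

lemma normalized_root_pair_sym:
  "normalized_root_pair T sroot coroot a b k \<Longrightarrow> normalized_root_pair T sroot coroot b a k"
  by (simp add: normalized_root_pair_def normalized_root_pair_axioms_def)

context normalized_root_pair
begin

text \<open>With \<open>swap\<close> the two roots trade places, so that a statement about the root
  \<open>a\<close> also yields its mirror image.\<close>

interpretation swap: normalized_root_pair T sroot coroot b a k
  by (rule normalized_root_pair_sym) unfold_locales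

text \<open>Splits off an innermost transform along \<open>a\<close>. An alternating word of length
  \<open>Suc n\<close> ends in \<open>a\<close> if it starts with \<open>a\<close> and
  \<open>n\<close> is even, or starts with \<open>b\<close> and \<open>n\<close> is odd. In the
  first case the coefficient belongs to \<open>sroot a\<close>, which also receives
  \<open>a.inf_coroot X\<close>.\<close>

lemma alternating_inf_pit:
  assumes X: "X \<in> paths T" and t: "0 \<le> t" "t \<le> T"
    and nonneg: "\<And>i. i \<le> Suc n \<Longrightarrow> 0 \<le> chebyshev_U k i"
  shows "even n \<Longrightarrow> alternating_inf (a.pit X) n t + a.inf_coroot X t = alternating_inf X (Suc n) t"
    and "odd n \<Longrightarrow> swap.alternating_inf (a.pit X) n t = swap.alternating_inf X (Suc n) t"
proof -
  let ?c = "\<lambda>s. coroot a (X s)" and ?d = "\<lambda>s. coroot b (X s)"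
  have co: "coroot a (a.pit X s) = ?c s - 2 * running_inf ?c s"
     "coroot b (a.pit X s) = ?d s + k * running_inf ?c s" if s: "0 \<le> s" "s \<le> T" for s
    using a.coroot_pit[OF s] s by (auto simp: a.pit_apply b.coroot_simps pairing)
  note key = nested_inf_transformed_from_1[OF a.continuous_coroot_path[OF X] b.continuous_coroot_path[OF X],
      of "Suc n" "chebyshev_U k" k n t, OF nonneg]
  show "alternating_inf (a.pit X) n t + a.inf_coroot X t = alternating_inf X (Suc n) t" if "even n"
  proof -
    have "alternating_inf (a.pit X) n t = nested_inf (\<lambda>i s. chebyshev_U k i *
      (if even (Suc n + i) then ?c s - 2 * running_inf ?c s else ?d s + k * running_inf ?c s)) n (Suc 0) t"
      unfolding alternating_inf_def using that by (intro nested_inf_cong[OF _ t]) (auto simp: co)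
    moreover have "alternating_inf X (Suc n) t = nested_inf (\<lambda>i s. chebyshev_U k i *
      (if even (Suc n + i) then ?c s else ?d s)) (Suc n) (Suc 0) t"
      unfolding alternating_inf_def using that by (intro nested_inf_cong[OF _ t]) auto
    ultimately show ?thesis using key t that by simp
  qed
  show "swap.alternating_inf (a.pit X) n t = swap.alternating_inf X (Suc n) t" if "odd n"
  proof -
    have "swap.alternating_inf (a.pit X) n t = nested_inf (\<lambda>i s. chebyshev_U k i *
      (if even (Suc n + i) then ?c s - 2 * running_inf ?c s else ?d s + k * running_inf ?c s)) n (Suc 0) t"
      unfolding swap.alternating_inf_def using that by (intro nested_inf_cong[OF _ t]) (auto simp: co)
    moreover have "swap.alternating_inf X (Suc n) t = nested_inf (\<lambda>i s. chebyshev_U k i *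
      (if even (Suc n + i) then ?c s else ?d s)) (Suc n) (Suc 0) t"
      unfolding swap.alternating_inf_def using that by (intro nested_inf_cong[OF _ t]) auto
    ultimately show ?thesis using key t that by simp
  qed
qed

end

context normalized_root_pair
begin

interpretation swap: normalized_root_pair T sroot coroot b a k
  by (rule normalized_root_pair_sym) unfold_locales

text \<open>Induction on the length, removing the innermost factor. The outermost factor changes
  only the multiple of \<open>sroot a\<close>, so the coefficient of \<open>sroot b\<close> comes
  from a word of \<open>n - 1\<close> letters; for \<open>n = 0\<close> the truncated difference
  rightly gives 0.\<close>

lemma pitman_word_alternating:
  assumes "X \<in> paths T" "0 \<le> t" "t \<le> T" "\<And>i. i \<le> n \<Longrightarrow> 0 \<le> chebyshev_U k i"
  shows "pitman_word sroot coroot T (alternating a b n) X t =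
    X t - alternating_inf X n t *\<^sub>R sroot a - swap.alternating_inf X (n - 1) t *\<^sub>R sroot b"
  using assms
proof (induction n arbitrary: X)
  case 0
  then show ?case by (simp add: pitman_word_def alternating_inf_def swap.alternating_inf_def)
next
  case (Suc n)
  note X = \<open>X \<in> paths T\<close> and t = Suc.prems(2,3) and nonneg = Suc.prems(4)
  show ?case
  proof (cases "even n")
    case True
    have "pitman_word sroot coroot T (alternating a b (Suc n)) X t =
        pitman_word sroot coroot T (alternating a b n) (a.pit X) t"
      using True by (simp only: alternating_snoc pitman_word_def) (simp add: pitman_eq_pitman_along)
    also have "\<dots> = a.pit X t - alternating_inf (a.pit X) n t *\<^sub>R sroot a
        - swap.alternating_inf (a.pit X) (n - 1) t *\<^sub>R sroot b"
      by (rule Suc.IH) (use X t nonneg in \<open>auto intro: a.pit_paths\<close>)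
    also have "swap.alternating_inf (a.pit X) (n - 1) t = swap.alternating_inf X n t"
    proof (cases n)
      case 0
      then show ?thesis by (simp add: swap.alternating_inf_def)
    next
      case (Suc n')
      then show ?thesis using alternating_inf_pit(2)[OF X t, of n'] nonneg True by simp
    qed
    finally show ?thesis
      using alternating_inf_pit(1)[OF X t nonneg, of n] True t
      by (simp add: a.pit_apply algebra_simps flip: scaleR_add_left)
  next
    case False
    then obtain n' where n': "n = Suc n'" by (cases n) auto
    have "pitman_word sroot coroot T (alternating a b (Suc n)) X t =
        pitman_word sroot coroot T (alternating a b n) (b.pit X) t"
      using False by (simp only: alternating_snoc pitman_word_def) (simp add: pitman_eq_pitman_along)
    also have "\<dots> = b.pit X t - alternating_inf (b.pit X) n t *\<^sub>R sroot a
        - swap.alternating_inf (b.pit X) (n - 1) t *\<^sub>R sroot b"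
      by (rule Suc.IH) (use X t nonneg in \<open>auto intro: b.pit_paths\<close>)
    also have "alternating_inf (b.pit X) n t = alternating_inf X (Suc n) t"
      using swap.alternating_inf_pit(2)[OF X t nonneg, of n] False by simp
    moreover have "swap.alternating_inf X n t *\<^sub>R sroot b =
        swap.alternating_inf (b.pit X) (n - 1) t *\<^sub>R sroot b + b.inf_coroot X t *\<^sub>R sroot b"
      using swap.alternating_inf_pit(1)[OF X t, of n'] False n' nonneg
      by (simp flip: scaleR_add_left)
    ultimately show ?thesis
      using t by (simp add: b.pit_apply del: alternating.simps)
  qed
qed

end

context normalized_root_pair
begin

interpretation swap: normalized_root_pair T sroot coroot b a k
  by (rule normalized_root_pair_sym) unfold_locales

lemma pitman_word_paths_pair:
  "X \<in> paths T \<Longrightarrow> set ws \<subseteq> {a, b} \<Longrightarrow> pitman_word sroot coroot T ws X \<in> paths T"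
  by (induction ws)
    (auto simp: pitman_word_def pitman_eq_pitman_along intro: a.pit_paths b.pit_paths)

lemma pitman_braid_normalized:
  assumes X: "X \<in> paths T" and nonneg: "\<And>i. i \<le> m \<Longrightarrow> 0 \<le> chebyshev_U k i"
    and zero: "chebyshev_U k m = 0"
  shows "pitman_word sroot coroot T (alternating a b m) X = pitman_word sroot coroot T (alternating b a m) X"
proof (rule paths_eqI)
  show "pitman_word sroot coroot T (alternating a b m) X \<in> paths T"
    using X set_alternating[of a b m] by (rule pitman_word_paths_pair)
  show "pitman_word sroot coroot T (alternating b a m) X \<in> paths T"
    using X set_alternating[of b a m] by (intro pitman_word_paths_pair) auto
  fix t assume t: "0 \<le> t" "t \<le> T"
  show "pitman_word sroot coroot T (alternating a b m) X t = pitman_word sroot coroot T (alternating b a m) X t"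
  proof (cases m)
    case (Suc n)
    then have "alternating_inf X m t = alternating_inf X (m - 1) t"
        "swap.alternating_inf X m t = swap.alternating_inf X (m - 1) t"
      using alternating_inf_drop_last[of n t X] swap.alternating_inf_drop_last[of n t X] zero t by simp_all
    then show ?thesis
      by (simp add: pitman_word_alternating[OF X t nonneg] swap.pitman_word_alternating[OF X t nonneg] algebra_simps)
  qed simp
qed

end

section \<open>Rescaling and the braid relations in rank two\<close>

lemma pitman_along_scale:
  assumes "root_direction T v f" "c > 0" "\<eta> \<in> paths T"
  shows "pitman_along T (c *\<^sub>R v) (\<lambda>x. inverse c * f x) \<eta> = pitman_along T v f \<eta>"
proof -
  interpret root_direction T v f by fact
  show ?thesis
    unfolding pitman_along_def
    using assms running_inf_scale[OF continuous_coroot_path[OF assms(3)], of "inverse c"]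
    by (intro restrict_ext) simp
qed

text \<open>Rescaling one root and its coroot makes the Cartan matrix symmetric without changing any
  Pitman transform.\<close>

lemma pitman_braid:
  assumes a: "root_direction T (sroot a) (coroot a)" and b: "root_direction T (sroot b) (coroot b)"
    and "a \<noteq> b" and m: "2 \<le> m" and X: "X \<in> paths T"
    and comm: "m = 2 \<Longrightarrow> coroot a (sroot b) = 0 \<and> coroot b (sroot a) = 0"
    and noncomm: "m \<noteq> 2 \<Longrightarrow> coroot a (sroot b) < 0 \<and> coroot b (sroot a) < 0 \<and>
      coroot a (sroot b) * coroot b (sroot a) = 4 * (cos (pi / real m))\<^sup>2"
  shows "pitman_word sroot coroot T (alternating a b m) X = pitman_word sroot coroot T (alternating b a m) X"
proof -
  interpret a: root_direction T "sroot a" "coroot a" by fact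
  interpret b: root_direction T "sroot b" "coroot b" by fact
  define k where "k = 2 * cos (pi / real m)"
  have k0: "0 \<le> k"
    unfolding k_def using m by (intro mult_nonneg_nonneg cos_ge_zero) (auto simp: field_simps intro: order_trans[of _ 0])
  \<comment> \<open>Both rescaled pairings must equal \<open>- k\<close>. As the product of the
    given ones is the square of \<open>k\<close>, the choice \<open>c = k / q\<close> achieves this;
    for \<open>m = 2\<close> they and \<open>k\<close> are all 0, and 1 is taken.\<close>
  obtain c where c: "c > 0" "coroot a (sroot b) = - (k * c)" "coroot b (sroot a) * c = - k"
  proof (cases "m = 2")
    case True
    then show ?thesis using that[of 1] comm by (simp add: k_def)
  next
    case False
    define p q where "p = - coroot a (sroot b)" and "q = - coroot b (sroot a)"
    have pq: "p > 0" "q > 0" "p * q = k\<^sup>2" using noncomm[OF False] by (auto simp: p_def q_def k_def power2_eq_square)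
    then have "k > 0" using k0 by (cases "k = 0") auto
    with pq show ?thesis using that[of "k / q"]
      by (simp add: p_def q_def field_simps power2_eq_square)
  qed
  define sroot' where "sroot' = sroot(a := c *\<^sub>R sroot a)"
  define coroot' where "coroot' = coroot(a := \<lambda>x. inverse c * coroot a x)"
  have eq: "pitman sroot' coroot' T s \<eta> = pitman sroot coroot T s \<eta>" if "\<eta> \<in> paths T" "s \<in> {a, b}" for s \<eta>
    using that \<open>a \<noteq> b\<close> pitman_along_scale[OF a c(1) that(1)]
    by (auto simp: pitman_eq_pitman_along sroot'_def coroot'_def)
  have "linear (\<lambda>x. inverse c * coroot a x)"
    using a.linear_coroot by (simp add: linear_iff algebra_simps)
  moreover have "continuous_on UNIV (\<lambda>x. inverse c * coroot a x)"
    using a.continuous_coroot by (rule continuous_on_mult_left)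
  ultimately have "root_direction T (sroot' a) (coroot' a)"
    using c(1) a.T_nonneg by unfold_locales (auto simp: sroot'_def coroot'_def a.coroot_simps a.coroot_self algebra_simps)
  moreover have "root_direction T (sroot' b) (coroot' b)"
    using b \<open>a \<noteq> b\<close> by (simp add: sroot'_def coroot'_def)
  ultimately interpret n: normalized_root_pair T sroot' coroot' a b k
    using c \<open>a \<noteq> b\<close> by (simp add: normalized_root_pair_def normalized_root_pair_axioms_def
        sroot'_def coroot'_def b.coroot_simps field_simps)
  have word: "pitman_word sroot' coroot' T ws X = pitman_word sroot coroot T ws X" if "set ws \<subseteq> {a, b}" for ws
    using that
  proof (induction ws)
    case (Cons s ws)
    then show ?case
      using eq[OF n.pitman_word_paths_pair[OF X, of ws], of s] by (simp add: pitman_word_def)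
  qed (simp add: pitman_word_def)
  show ?thesis
    using n.pitman_braid_normalized[OF X, of m] chebyshev_U_dihedral[OF m] set_alternating[of a b m]
      set_alternating[of b a m] word by (auto simp: k_def insert_commute)
qed

section \<open>Matsumoto's theorem\<close>

text \<open>In contrast to \<open>coxeter_equiv\<close> there is no cancellation of letters, so
  lengths are preserved. An infinite order is 0, which makes both alternating words empty and the
  relation trivial.\<close>

inductive braid_equiv :: "('g, 'm) monoid_scheme \<Rightarrow> 'g set \<Rightarrow> 'g list \<Rightarrow> 'g list \<Rightarrow> bool"
  for W (structure) and S where
  refl: "u \<in> lists S \<Longrightarrow> braid_equiv W S u u"
| sym: "braid_equiv W S u v \<Longrightarrow> braid_equiv W S v u"
| trans: "braid_equiv W S u v \<Longrightarrow> braid_equiv W S v w \<Longrightarrow> braid_equiv W S u w"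
| braid: "u \<in> lists S \<Longrightarrow> v \<in> lists S \<Longrightarrow> s \<in> S \<Longrightarrow> t \<in> S \<Longrightarrow> s \<noteq> t \<Longrightarrow>
    braid_equiv W S (u @ alternating s t (group.ord W (s \<otimes> t)) @ v)
      (u @ alternating t s (group.ord W (s \<otimes> t)) @ v)"

lemma braid_equiv_append:
  assumes "braid_equiv W S u v" "x \<in> lists S" "y \<in> lists S"
  shows "braid_equiv W S (x @ u @ y) (x @ v @ y)"
  using assms(1)
proof induction
  case (refl u)
  then show ?case using assms(2,3) by (intro braid_equiv.refl) auto
next
  case (braid u v s t)
  then show ?case using assms(2,3) braid_equiv.braid[of "x @ u" S "v @ y" s t W] by simp
qed (blast intro: braid_equiv.sym braid_equiv.trans)+

lemma alternating_add:
  "alternating a b (j + l) = alternating a b j @ (if even j then alternating a b l else alternating b a l)"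
  by (induction j arbitrary: a b) auto

lemma concat_replicate_pair: "concat (replicate n [s, t]) = alternating s t (2 * n)"
  by (induction n) auto

section \<open>Words, reduced words and the exchange condition\<close>

context coxeter_system
begin

declare in_listsI [rule del] in_listsD [rule del]

abbreviation val :: "'g list \<Rightarrow> 'g" where
  "val \<equiv> word_value W"

lemma S_closed [simp]: "s \<in> S \<Longrightarrow> s \<in> carrier W"
  using S_carrier by auto

lemma S_square [simp]: "s \<in> S \<Longrightarrow> s \<otimes> s = \<one>"
  using involution by blast

lemma S_square_left [simp]: "s \<in> S \<Longrightarrow> x \<in> carrier W \<Longrightarrow> s \<otimes> (s \<otimes> x) = x"
  by (simp flip: m_assoc)

lemma val_simps [simp]: "val [] = \<one>" "val (s # ws) = s \<otimes> val ws"
  by (simp_all add: word_value_def)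

lemma val_closed [simp]: "ws \<in> lists S \<Longrightarrow> val ws \<in> carrier W"
  by (induction ws) auto

lemma val_append: "u \<in> lists S \<Longrightarrow> v \<in> lists S \<Longrightarrow> val (u @ v) = val u \<otimes> val v"
  by (induction u) (auto simp: m_assoc)

lemma alternating_lists: "s \<in> S \<Longrightarrow> t \<in> S \<Longrightarrow> alternating s t n \<in> lists S"
  by (induction n arbitrary: s t) auto

lemma val_exists:
  assumes "w \<in> carrier W"
  obtains ws where "ws \<in> lists S" "val ws = w"
proof -
  have "w \<in> generate W S" using assms generators by simp
  then have "\<exists>ws\<in>lists S. val ws = w"
  proof induction
    case one
    show ?case by (rule bexI[of _ "[]"]) auto
  next
    case (incl h)
    then show ?case by (intro bexI[of _ "[h]"]) auto
  next
    case (inv h)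
    then have "inv h = h" by (simp add: inv_equality)
    with inv show ?case by (intro bexI[of _ "[h]"]) auto
  next
    case (eng h1 h2)
    then obtain u v where "u \<in> lists S" "v \<in> lists S" "val u = h1" "val v = h2" by auto
    then show ?case by (intro bexI[of _ "u @ v"]) (auto simp: val_append)
  qed
  then show ?thesis using that by auto
qed

lemma coxeter_length_le: "ws \<in> lists S \<Longrightarrow> coxeter_length W S (val ws) \<le> length ws"
  unfolding coxeter_length_def by (rule Least_le) auto

lemma reduced_decomposition_exists:
  assumes "w \<in> carrier W"
  obtains ws where "reduced_decomposition W S w ws"
proof -
  obtain us where "us \<in> lists S" "val us = w" using val_exists assms by blast
  then have "\<exists>n. \<exists>ws\<in>lists S. length ws = n \<and> val ws = w" by blast
  from LeastI_ex[OF this] show ?thesis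
    using that unfolding reduced_decomposition_def coxeter_length_def by blast
qed

text \<open>Minimality is stated for words alone, without the length function, which suits cutting
  words and replacing their factors.\<close>

definition reduced :: "'g list \<Rightarrow> bool" where
  "reduced ws \<longleftrightarrow> ws \<in> lists S \<and> (\<forall>vs\<in>lists S. val vs = val ws \<longrightarrow> length ws \<le> length vs)"

lemma reduced_decomposition_iff: "reduced_decomposition W S w ws \<longleftrightarrow> reduced ws \<and> val ws = w"
proof
  assume r: "reduced_decomposition W S w ws"
  then show "reduced ws \<and> val ws = w"
    unfolding reduced_decomposition_def reduced_def by (metis coxeter_length_le)
next
  assume r: "reduced ws \<and> val ws = w"
  then have "w \<in> carrier W" using val_closed unfolding reduced_def by blast
  then obtain vs where "reduced_decomposition W S w vs" by (rule reduced_decomposition_exists)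
  with r have "length ws \<le> coxeter_length W S w"
    unfolding reduced_decomposition_def reduced_def by metis
  then show "reduced_decomposition W S w ws"
    using r coxeter_length_le[of ws] by (auto simp: reduced_decomposition_def reduced_def)
qed

lemma reduced_appendD:
  assumes "reduced (u @ v)"
  shows "reduced u" "reduced v"
proof -
  have l: "u \<in> lists S" "v \<in> lists S" using assms by (auto simp: reduced_def)
  show "reduced u"
    unfolding reduced_def
  proof (intro conjI ballI impI)
    fix x assume "x \<in> lists S" "val x = val u"
    then have "length (u @ v) \<le> length (x @ v)"
      using assms l unfolding reduced_def by (metis append_in_lists_conv val_append)
    then show "length u \<le> length x" by simp
  qed fact
  show "reduced v"
    unfolding reduced_def
  proof (intro conjI ballI impI)
    fix x assume "x \<in> lists S" "val x = val v"
    then have "length (u @ v) \<le> length (u @ x)"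
      using assms l unfolding reduced_def by (metis append_in_lists_conv val_append)
    then show "length v \<le> length x" by simp
  qed fact
qed

lemma reduced_cong:
  "reduced u \<Longrightarrow> v \<in> lists S \<Longrightarrow> val v = val u \<Longrightarrow> length v \<le> length u \<Longrightarrow> reduced v"
  unfolding reduced_def by (metis order_trans)

text \<open>For \<open>ws = s\<^sub>1 \<dots> s\<^sub>n\<close> these are the reflections \<open>s\<^sub>1 \<dots> s\<^sub>i \<dots> s\<^sub>1\<close>. The parity of the multiplicity of
  each of them only depends on the value of \<open>ws\<close>, which yields the exchange condition.\<close>

primrec reflections :: "'g list \<Rightarrow> 'g list" where
  "reflections [] = []"
| "reflections (s # ws) = s # map (\<lambda>t. s \<otimes> t \<otimes> s) (reflections ws)"

lemma reflections_closed: "ws \<in> lists S \<Longrightarrow> set (reflections ws) \<subseteq> carrier W"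
  by (induction ws) auto

lemma reflections_append:
  assumes "u \<in> lists S" "v \<in> lists S"
  shows "reflections (u @ v) = reflections u @ map (\<lambda>t. val u \<otimes> t \<otimes> inv (val u)) (reflections v)"
  using assms(1)
proof (induction u)
  case Nil
  then show ?case using reflections_closed[OF assms(2)] by (auto intro!: map_idI[symmetric])
next
  case (Cons s u)
  then have "inv s = s" by (simp add: inv_equality)
  with Cons show ?case
    using reflections_closed[OF assms(2)]
    by (auto simp: subset_iff inv_mult_group m_assoc intro!: map_cong)
qed

text \<open>The reflections are values of alternating palindromes: conjugation by \<open>s\<close>
  prolongs a palindrome starting with \<open>t\<close> by one letter at each end.\<close>

lemma reflections_alternating:
  assumes "s \<in> S" "t \<in> S"
  shows "reflections (alternating s t n) = map (\<lambda>i. val (alternating s t (Suc (2 * i)))) [0..<n]"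
  using assms
proof (induction n arbitrary: s t)
  case (Suc n)
  have *: "s \<otimes> val (alternating t s (Suc (2 * i))) \<otimes> s = val (alternating s t (Suc (2 * Suc i)))" for i
  proof -
    have "alternating s t (Suc (2 * Suc i)) = (s # alternating t s (Suc (2 * i))) @ [s]"
      by (subst alternating_snoc) simp
    then show ?thesis
      using Suc.prems alternating_lists[of t s "Suc (2 * i)"]
      by (simp add: val_append m_assoc del: alternating.simps)
  qed
  have "reflections (alternating s t (Suc n)) =
      val (alternating s t (Suc (2 * 0))) # map (\<lambda>i. val (alternating s t (Suc (2 * Suc i)))) [0..<n]"
    using Suc.IH[of t s] Suc.prems * by (simp del: alternating.simps(2) add: alternating.simps(2)[of s t n] alternating.simps(2)[of s t 0])
  then show ?case by (simp only: upt_conv_Cons[of 0 "Suc n"] zero_less_Suc list.map map_Suc_upt[symmetric] map_map o_def)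
qed simp

lemma val_alternating_double: "s \<in> S \<Longrightarrow> t \<in> S \<Longrightarrow> val (alternating s t (2 * n)) = (s \<otimes> t) [^] n"
proof (induction n)
  case (Suc n)
  then show ?case using nat_pow_Suc2[of "s \<otimes> t" n] by (simp add: m_assoc)
qed simp

lemma conj_pow_Suc:
  assumes "s \<in> carrier W" "t \<in> carrier W"
  shows "s \<otimes> (t \<otimes> s) [^] n \<otimes> t = (s \<otimes> t) [^] Suc n"
proof (induction n)
  case (Suc n)
  have "s \<otimes> (t \<otimes> s) [^] Suc n \<otimes> t = (s \<otimes> (t \<otimes> s) [^] n \<otimes> t) \<otimes> (s \<otimes> t)"
    using assms by (simp add: m_assoc)
  then show ?case using Suc by simp
qed (use assms in simp)

text \<open>A prefix of twice the order many letters has trivial value, so the palindromes, and with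
  them the reflections, repeat after \<open>ord (s \<otimes> t)\<close> steps.\<close>

lemma reflections_relator:
  assumes "s \<in> S" "t \<in> S"
  obtains L where "reflections (alternating s t (2 * ord (s \<otimes> t))) = L @ L"
proof -
  let ?m = "ord (s \<otimes> t)"
  let ?g = "\<lambda>i. val (alternating s t (Suc (2 * i)))"
  have "?g (i + ?m) = ?g i" for i
  proof -
    have "alternating s t (Suc (2 * (i + ?m))) = alternating s t (2 * ?m) @ alternating s t (Suc (2 * i))"
      using alternating_add[of s t "2 * ?m" "Suc (2 * i)"] by (simp add: algebra_simps del: alternating.simps)
    then show ?thesis
      using assms alternating_lists by (simp add: val_append val_alternating_double pow_ord_eq_1 del: alternating.simps)
  qed
  then have "map ?g [?m..<?m + ?m] = map ?g [0..<?m]"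
    by (simp add: map_add_upt[of "?m" "?m", symmetric] del: alternating.simps)
  moreover have "map ?g [0..<2 * ?m] = map ?g [0..<?m] @ map ?g [?m..<?m + ?m]"
    by (simp add: mult_2 upt_add_eq_append[of 0] del: alternating.simps)
  ultimately show ?thesis
    using that reflections_alternating[OF assms] by metis
qed

text \<open>By \<open>reflections_relator\<close> a relator adds every reflection an even number of
  times; having trivial value, it does not alter the reflections of the letters behind it.\<close>

lemma coxeter_equiv_parity:
  assumes "coxeter_equiv W S u v"
  shows "even (count_list (reflections u) t) = even (count_list (reflections v) t) \<and>
    even (length u) = even (length v)"
  using assms
proof induction
  case (relator u v a b)
  let ?r = "alternating a b (2 * ord (a \<otimes> b))"
  obtain L where L: "reflections ?r = L @ L" using reflections_relator relator by blast
  have r: "?r \<in> lists S" "val ?r = \<one>"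
    using relator by (auto simp: alternating_lists val_alternating_double pow_ord_eq_1)
  have "reflections (?r @ v) = L @ L @ reflections v"
    using reflections_append[OF r(1), of v] r(2) L relator reflections_closed[of v]
    by (auto intro!: map_idI)
  then show ?case
    using relator r reflections_append[of u "?r @ v"] reflections_append[of u v]
    by (auto simp: concat_replicate_pair)
qed auto

text \<open>Here the Coxeter presentation enters: words of equal value are linked by
  relators.\<close>

lemma val_eq_parity:
  assumes "u \<in> lists S" "v \<in> lists S" "val u = val v"
  shows "even (count_list (reflections u) t) = even (count_list (reflections v) t)"
    and "even (length u) = even (length v)"
  using coxeter_equiv_parity[OF presentation[OF assms], of t] by auto

text \<open>Multiplying from the left by the \<open>i\<close>-th reflection cancels the prefix up to
  the \<open>i\<close>-th letter and restores it without that letter.\<close>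

lemma deletion:
  assumes "ws \<in> lists S" "t \<in> set (reflections ws)"
  obtains i where "i < length ws" "t \<otimes> val ws = val (take i ws @ drop (Suc i) ws)"
proof -
  have "\<exists>i<length ws. t \<otimes> val ws = val (take i ws @ drop (Suc i) ws)"
    using assms
  proof (induction ws arbitrary: t)
    case (Cons s ws)
    show ?case
    proof (cases "t = s")
      case True
      then show ?thesis using Cons.prems Cons.hyps by (auto intro!: exI[of _ 0])
    next
      case False
      then obtain t' where t': "t' \<in> set (reflections ws)" "t = s \<otimes> t' \<otimes> s" using Cons.prems Cons.hyps by auto
      then have "t' \<in> carrier W" using reflections_closed[of ws] Cons.prems Cons.hyps by auto
      then have "t \<otimes> val (s # ws) = s \<otimes> (t' \<otimes> val ws)"
        using Cons.prems Cons.hyps t' by (simp add: m_assoc)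
      moreover obtain i where "i < length ws" "t' \<otimes> val ws = val (take i ws @ drop (Suc i) ws)"
        using Cons t' by auto
      ultimately show ?thesis by (intro exI[of _ "Suc i"]) simp
    qed
  qed simp
  then show ?thesis using that by blast
qed

text \<open>If the first letter \<open>s\<close> occurred again, undoing the conjugation would make
  \<open>s\<close> a reflection of \<open>ws\<close>, and deletion would shorten
  \<open>s # ws\<close>.\<close>

lemma distinct_reflections: "reduced ws \<Longrightarrow> distinct (reflections ws)"
proof (induction ws)
  case (Cons s ws)
  have s: "s \<in> S" and ws: "ws \<in> lists S" using Cons.prems by (auto simp: reduced_def)
  have "reduced ws" using reduced_appendD(2)[of "[s]" ws] Cons.prems by simp
  then have "distinct (reflections ws)" by (rule Cons.IH)
  moreover have inj: "inj_on (\<lambda>t. s \<otimes> t \<otimes> s) (carrier W)"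
    using s by (auto simp: inj_on_def)
  moreover have "s \<notin> (\<lambda>t. s \<otimes> t \<otimes> s) ` set (reflections ws)"
  proof
    assume "s \<in> (\<lambda>t. s \<otimes> t \<otimes> s) ` set (reflections ws)"
    then obtain t where t: "t \<in> set (reflections ws)" "s \<otimes> t \<otimes> s = s \<otimes> s \<otimes> s"
      using s by auto
    then have "t = s" using inj_onD[OF inj, of t s] s reflections_closed[OF ws] by auto
    then obtain i where i: "i < length ws" "s \<otimes> val ws = val (take i ws @ drop (Suc i) ws)"
      using deletion[OF ws] t by blast
    moreover have "take i ws @ drop (Suc i) ws \<in> lists S"
      using ws by (auto simp: in_lists_conv_set dest: in_set_takeD in_set_dropD)
    ultimately have "length (s # ws) \<le> length (take i ws @ drop (Suc i) ws)"
      using Cons.prems by (auto simp: reduced_def)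
    then show False using i by simp
  qed
  ultimately show ?case
    using reflections_closed[OF ws] by (auto simp: distinct_map intro: inj_on_subset)
qed simp

text \<open>The reflection \<open>t\<close> occurs exactly once for \<open>t # v\<close>, hence an
  odd number of times for \<open>u\<close>, so that \<open>deletion\<close> applies to
  \<open>u\<close>.\<close>

lemma exchange:
  assumes u: "reduced u" and v: "reduced (t # v)" and eq: "val u = val (t # v)"
  obtains i where "i < length u" "val (t # take i u @ drop (Suc i) u) = val u"
    "t # take i u @ drop (Suc i) u \<in> lists S"
proof -
  have l: "u \<in> lists S" "v \<in> lists S" "t \<in> S" using u v by (auto simp: reduced_def)
  have "count_list (reflections (t # v)) t = 1"
    using distinct_reflections[OF v] by (simp add: count_list_0_iff del: count_list.simps(1))
  then have "odd (count_list (reflections u) t)"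
    using val_eq_parity(1)[OF l(1) _ eq, of t] l by auto
  then have "t \<in> set (reflections u)"
    by (metis count_list_0_iff even_zero)
  then obtain i where i: "i < length u" "t \<otimes> val u = val (take i u @ drop (Suc i) u)"
    using deletion[OF l(1)] by blast
  moreover have "t # take i u @ drop (Suc i) u \<in> lists S"
    using l by (auto simp: in_lists_conv_set dest: in_set_takeD in_set_dropD)
  ultimately show ?thesis using that[of i] l by (simp flip: i(2))
qed

section \<open>Alternating words and Matsumoto's theorem\<close>

lemma val_alternating_quotient:
  "s \<in> S \<Longrightarrow> t \<in> S \<Longrightarrow> val (alternating s t n) \<otimes> inv (val (alternating t s n)) = (s \<otimes> t) [^] n"
proof (induction n arbitrary: s t)
  case (Suc n)
  have l: "val (alternating s t n) \<in> carrier W" "val (alternating t s n) \<in> carrier W"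
    using Suc.prems by (auto intro!: val_closed alternating_lists)
  have "inv t = t" using Suc.prems by (simp add: inv_equality)
  then have "val (alternating s t (Suc n)) \<otimes> inv (val (alternating t s (Suc n))) =
      s \<otimes> (val (alternating t s n) \<otimes> inv (val (alternating s t n))) \<otimes> t"
    using Suc.prems l by (simp add: inv_mult_group m_assoc)
  also have "\<dots> = s \<otimes> (t \<otimes> s) [^] n \<otimes> t" using Suc by simp
  also have "\<dots> = (s \<otimes> t) [^] Suc n"
    using Suc.prems by (intro conj_pow_Suc) auto
  finally show ?case .
qed simp

lemma val_alternating_eq_iff:
  assumes "s \<in> S" "t \<in> S"
  shows "val (alternating s t n) = val (alternating t s n) \<longleftrightarrow> ord (s \<otimes> t) dvd n"
proof -
  have l: "val (alternating s t n) \<in> carrier W" "val (alternating t s n) \<in> carrier W"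
    using assms by (auto intro!: val_closed alternating_lists)
  have "ord (s \<otimes> t) dvd n \<longleftrightarrow> val (alternating s t n) \<otimes> inv (val (alternating t s n)) = \<one>"
    using val_alternating_quotient[OF assms] pow_eq_id[of "s \<otimes> t" n] assms by simp
  also have "\<dots> \<longleftrightarrow> val (alternating s t n) = val (alternating t s n)"
    using l by (metis inv_closed inv_solve_right l_one one_closed)
  finally show ?thesis by simp
qed

text \<open>A longer word has an alternating prefix with one letter more than the order. A braid
  move on all but the first letter of it puts two equal letters side by side.\<close>

lemma reduced_alternating_length:
  assumes "s \<in> S" "t \<in> S" "reduced (alternating s t n)" "ord (s \<otimes> t) \<noteq> 0"
  shows "n \<le> ord (s \<otimes> t)"
proof (rule ccontr)
  assume "\<not> ?thesis"
  then obtain l where n: "n = Suc (ord (s \<otimes> t)) + l" using less_iff_Suc_add by (metis add_Suc not_le)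
  obtain m where m: "ord (s \<otimes> t) = Suc m" using assms(4) not0_implies_Suc by blast
  have "val (alternating s t (Suc (Suc m))) = s \<otimes> val (alternating t s (Suc m))" by simp
  also have "val (alternating t s (Suc m)) = val (alternating s t (Suc m))"
    using val_alternating_eq_iff[of s t "Suc m"] assms m by (metis dvd_refl)
  finally have v: "val (alternating s t (Suc (Suc m))) = val (alternating t s m)"
    using assms by (simp add: alternating_lists)
  have red: "reduced (alternating s t (Suc (Suc m)))"
    using assms(3) alternating_add[of s t "Suc (Suc m)" l] reduced_appendD(1) n m by metis
  have "alternating t s m \<in> lists S" using assms by (intro alternating_lists)
  then have "length (alternating s t (Suc (Suc m))) \<le> length (alternating t s m)"
    using red v unfolding reduced_def by metis
  then show False by simp
qed

text \<open>Bourbaki's argument: if \<open>u\<close> and \<open>v\<close> were a counterexample of minimal length, repeated exchange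
  would turn it into a counterexample made of two alternating words.\<close>

theorem matsumoto:
  assumes "reduced u" "reduced v" "val u = val v"
  shows "braid_equiv W S u v"
proof -
  have "length u = length v"
    using assms by (auto simp: reduced_def intro!: order.antisym)
  with assms show ?thesis
  proof (induction "length u" arbitrary: u v)
    case 0
    then show ?case by (auto intro: braid_equiv.refl)
  next
    case (Suc n)
    define R where "R x \<longleftrightarrow> reduced x \<and> val x = val u \<and> length x = Suc n" for x
    let ?B = "braid_equiv W S"
    have R_lists: "x \<in> lists S" if "R x" for x using that by (auto simp: R_def reduced_def)
    have same_hd: "?B (s # x) (s # y)" if "R (s # x)" "R (s # y)" for s x y
    proof -
      have l: "s \<in> S" "x \<in> lists S" "y \<in> lists S" using that[THEN R_lists] by auto
      have "reduced x" "reduced y" using that reduced_appendD(2)[of "[s]"] by (auto simp: R_def)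
      moreover have "s \<otimes> val x = s \<otimes> val y" using that by (simp add: R_def)
      then have "val x = val y" using l by (metis S_square_left val_closed)
      ultimately have "?B x y" using Suc.hyps(1)[of x y] that by (auto simp: R_def)
      then show ?thesis using braid_equiv_append[of W S x y "[s]" "[]"] l by simp
    qed
    have same_last: "?B (x @ [s]) (y @ [s])" if "R (x @ [s])" "R (y @ [s])" for s x y
    proof -
      have l: "s \<in> S" "x \<in> lists S" "y \<in> lists S" using that[THEN R_lists] by auto
      have "reduced x" "reduced y" using that reduced_appendD(1)[of _ "[s]"] by (auto simp: R_def)
      moreover have "val x \<otimes> s \<otimes> s = val y \<otimes> s \<otimes> s" using that l by (simp add: R_def val_append)
      then have "val x = val y" using l by (simp add: m_assoc)
      ultimately have "?B x y" using Suc.hyps(1)[of x y] that by (auto simp: R_def)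
      then show ?thesis using braid_equiv_append[of W S x y "[]" "[s]"] l by simp
    qed
    \<comment> \<open>Exchange gives a word \<open>?z\<close> that starts with \<open>b\<close> and
      is equivalent to \<open>b # y\<close> by \<open>same_hd\<close>. Were the deleted letter not
      the last one, \<open>?z\<close> and \<open>x\<close> would share their last letter and be
      equivalent. So \<open>?z\<close> is \<open>b # butlast x\<close>, and paired with
      \<open>x\<close> it is a new counterexample.\<close>
    have step: "R (b # butlast x) \<and> \<not> ?B (b # butlast x) x"
      if x: "R x" and y: "R (b # y)" and neg: "\<not> ?B x (b # y)" for x y b
    proof -
      obtain i where i: "i < length x" "val (b # take i x @ drop (Suc i) x) = val x"
          "b # take i x @ drop (Suc i) x \<in> lists S"
        by (rule exchange[of x b y]) (use x y in \<open>auto simp: R_def\<close>)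
      let ?z = "b # take i x @ drop (Suc i) x"
      have "length ?z = length x" using i by auto
      then have z: "R ?z" using reduced_cong[of x ?z] i x unfolding R_def by auto
      have zy: "?B ?z (b # y)" using same_hd z y by blast
      have "i = n"
      proof (rule ccontr)
        assume "i \<noteq> n"
        then have "i < n" using i x by (auto simp: R_def)
        then have ne: "drop (Suc i) x \<noteq> []" using x by (auto simp: R_def)
        have "x = butlast x @ [last x]" using x by (auto simp: R_def intro!: append_butlast_last_id[symmetric])
        moreover have "?z = (b # take i x @ butlast (drop (Suc i) x)) @ [last x]"
          using ne by (metis append_Cons append_assoc append_butlast_last_id last_drop not_less drop_eq_Nil)
        ultimately have "?B x ?z" using same_last[of "butlast x" "last x" "b # take i x @ butlast (drop (Suc i) x)"] x z
          by metis
        then show False using neg zy braid_equiv.trans by metis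
      qed
      then have "?z = b # butlast x" using x by (simp add: R_def butlast_conv_take)
      then show ?thesis using z zy neg braid_equiv.sym braid_equiv.trans by metis
    qed
    show ?case
    proof (rule ccontr)
      assume neg: "\<not> ?B u v"
      have uv: "R u" "R v" using Suc.prems Suc.hyps(2) by (auto simp: R_def)
      \<comment> \<open>Each use of \<open>step\<close> puts the second word's first letter in front
        of \<open>x\<close>, which lengthens the alternating beginning by one; the old
        \<open>x\<close> becomes the other word.\<close>
      have inv: "\<exists>a b x y. R x \<and> R (b # y) \<and> \<not> ?B x (b # y) \<and> take (Suc k) x = alternating a b (Suc k)"
        if "k \<le> n" for k
        using that
      proof (induction k)
        case 0
        obtain a x where "u = a # x" using uv(1) by (cases u) (auto simp: R_def)
        moreover obtain b y where "v = b # y" using uv(2) by (cases v) (auto simp: R_def)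
        ultimately show ?case
          using uv neg by (intro exI[of _ a] exI[of _ b] exI[of _ u] exI[of _ y]) auto
      next
        case (Suc k)
        then obtain a b x y where *: "R x" "R (b # y)" "\<not> ?B x (b # y)" "take (Suc k) x = alternating a b (Suc k)"
          by auto
        obtain x' where x': "x = a # x'" using *(1,4) by (cases x) (auto simp: R_def)
        have "R (b # butlast x)" "\<not> ?B (b # butlast x) (a # x')" using step[OF *(1-3)] x' by auto
        moreover have "take (Suc (Suc k)) (b # butlast x) = alternating b a (Suc (Suc k))"
          using *(1,4) Suc.prems by (simp add: butlast_conv_take R_def min_def del: alternating.simps(2))
            (simp add: x')
        ultimately show ?case using *(1) x' by metis
      qed
      obtain a b x y where *: "R x" "R (b # y)" "\<not> ?B x (b # y)" "take (Suc n) x = alternating a b (Suc n)"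
        using inv[of n] by auto
      have x: "x = alternating a b (Suc n)" using * by (simp add: R_def)
      have "butlast x = alternating a b n" unfolding x by (simp add: alternating_snoc del: alternating.simps)
      then have y: "R (alternating b a (Suc n))" "\<not> ?B (alternating b a (Suc n)) (alternating a b (Suc n))"
        using step[OF *(1-3)] x by auto
      have ab: "a \<in> S" "b \<in> S" using R_lists[OF *(1)] R_lists[OF *(2)] x by auto
      have "a \<noteq> b" using y(2) braid_equiv.refl[OF R_lists[OF y(1)]] by auto
      \<comment> \<open>Equal values make the order divide the length, and reducedness bounds the
        length by the order; so the two words are the sides of one braid relation.\<close>
      have "ord (a \<otimes> b) dvd Suc n"
        using val_alternating_eq_iff[of a b "Suc n"] *(1) x y(1) ab by (simp add: R_def)
      moreover from this have "ord (a \<otimes> b) \<noteq> 0" by (metis dvd_0_left_iff nat.distinct(2))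
      moreover have "Suc n \<le> ord (a \<otimes> b)"
        using reduced_alternating_length[of a b "Suc n"] ab *(1) x calculation(2) by (simp add: R_def)
      ultimately have "ord (a \<otimes> b) = Suc n" using dvd_imp_le[of "ord (a \<otimes> b)" "Suc n"] by simp
      then have "?B (alternating a b (Suc n)) (alternating b a (Suc n))"
        using braid_equiv.braid[of "[]" S "[]" a b W] ab \<open>a \<noteq> b\<close> by simp
      then show False using y(2) braid_equiv.sym by blast
    qed
  qed
qed

text \<open>Multiplication by \<open>s\<close> cannot increase the length of \<open>w0\<close> and
  changes its parity, so it shortens \<open>w0\<close>; appending \<open>s\<close> to a reduced word
  of the product gives the desired word.\<close>

lemma longest_element_ends_with:
  assumes w0: "longest_element W S w0" and s: "s \<in> S"
  obtains us where "reduced_decomposition W S w0 (us @ [s])"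
proof -
  have c: "w0 \<in> carrier W" using w0 by (simp add: longest_element_def)
  then obtain ws where ws: "reduced_decomposition W S w0 ws" by (rule reduced_decomposition_exists)
  obtain us where us: "reduced_decomposition W S (w0 \<otimes> s) us"
    using reduced_decomposition_exists[of "w0 \<otimes> s"] c s by auto
  have l: "us @ [s] \<in> lists S" "val (us @ [s]) = w0"
    using us c s by (auto simp: reduced_decomposition_def val_append m_assoc)
  have "length us \<le> length ws"
    using w0 us ws c s by (auto simp: longest_element_def reduced_decomposition_def)
  moreover have "even (length ws) = even (length (us @ [s]))"
    using val_eq_parity(2)[of ws "us @ [s]"] l ws by (auto simp: reduced_decomposition_def)
  ultimately have "length (us @ [s]) \<le> length ws" by (cases "length us = length ws") auto
  then have "reduced_decomposition W S w0 (us @ [s])"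
    using ws l reduced_cong[of ws "us @ [s]"] by (auto simp: reduced_decomposition_iff)
  then show ?thesis using that by blast
qed

end

section \<open>The crystal on a fibre\<close>

lemma pitman_word_Nil [simp]: "pitman_word sroot coroot T [] \<eta> = \<eta>"
  and pitman_word_Cons [simp]:
    "pitman_word sroot coroot T (s # ws) \<eta> = pitman sroot coroot T s (pitman_word sroot coroot T ws \<eta>)"
  and pitman_word_append: "pitman_word sroot coroot T (u @ v) \<eta> =
    pitman_word sroot coroot T u (pitman_word sroot coroot T v \<eta>)"
  by (simp_all add: pitman_word_def)

lemma path_eps_eq: "path_eps coroot T s \<eta> = - running_inf (\<lambda>u. coroot s (\<eta> u)) T"
  by (simp add: path_eps_def running_inf_def)

lemma path_phi_eq: "path_phi coroot T s \<eta> = path_eps coroot T s \<eta> + coroot s (\<eta> T)"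
  by (simp add: path_eps_def path_phi_def)

context coxeter_realization
begin

section \<open>Pitman transforms of group elements\<close>

lemma root_direction: "s \<in> S \<Longrightarrow> 0 \<le> T \<Longrightarrow> root_direction T (sroot s) (coroot s)"
  using linear_imp_continuous_on_finite_dim[OF finite_dimensional coroot_linear]
  by (simp add: root_direction_def coroot_linear coroot_root)

lemma pitman_paths: "s \<in> S \<Longrightarrow> 0 \<le> T \<Longrightarrow> \<eta> \<in> paths T \<Longrightarrow> pitman sroot coroot T s \<eta> \<in> paths T"
  by (simp add: pitman_eq_pitman_along root_direction.pit_paths[OF root_direction])

lemma pitman_word_paths:
  "set ws \<subseteq> S \<Longrightarrow> 0 \<le> T \<Longrightarrow> \<eta> \<in> paths T \<Longrightarrow> pitman_word sroot coroot T ws \<eta> \<in> paths T"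
  by (induction ws) (auto intro: pitman_paths)

lemma order_ge_2:
  assumes "s \<in> S" "t \<in> S" "s \<noteq> t" "ord (s \<otimes> t) \<noteq> 0"
  shows "2 \<le> ord (s \<otimes> t)"
proof -
  have "s \<otimes> t \<noteq> \<one>"
  proof
    assume "s \<otimes> t = \<one>"
    then have "s \<otimes> (s \<otimes> t) = s" using assms by simp
    then show False using assms by simp
  qed
  then show ?thesis using ord_eq_1[of "s \<otimes> t"] assms by (cases "ord (s \<otimes> t)") (auto simp: Suc_le_eq)
qed

lemma pitman_word_braid:
  assumes "s \<in> S" "t \<in> S" "s \<noteq> t" "0 \<le> T" "\<eta> \<in> paths T"
  shows "pitman_word sroot coroot T (alternating s t (ord (s \<otimes> t))) \<eta> =
    pitman_word sroot coroot T (alternating t s (ord (s \<otimes> t))) \<eta>"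
proof (cases "ord (s \<otimes> t) = 0")
  case False
  then show ?thesis
    using assms order_ge_2[of s t] commuting[of s t] noncommuting[of s t]
    by (intro pitman_braid root_direction) auto
qed simp

lemma pitman_word_braid_equiv:
  assumes "braid_equiv W S u v" "0 \<le> T" "\<eta> \<in> paths T"
  shows "pitman_word sroot coroot T u \<eta> = pitman_word sroot coroot T v \<eta>"
  using assms(1)
proof induction
  case (braid u v s t)
  then have "pitman_word sroot coroot T v \<eta> \<in> paths T"
    using assms by (intro pitman_word_paths) (auto simp: in_lists_conv_set)
  then show ?case
    using braid assms by (simp add: pitman_word_append pitman_word_braid[of s t T "pitman_word sroot coroot T v \<eta>"])
qed auto

text \<open>The word chosen in \<open>pitman_elt\<close> can be replaced by any reduced one, since
  Matsumoto's theorem joins the two by braid moves.\<close>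

lemma pitman_elt_eq_word:
  assumes "reduced_decomposition W S w ws" "0 \<le> T" "\<eta> \<in> paths T"
  shows "pitman_elt W S sroot coroot T w \<eta> = pitman_word sroot coroot T ws \<eta>"
proof -
  define us where "us = (SOME ws. reduced_decomposition W S w ws)"
  have "reduced_decomposition W S w us"
    unfolding us_def using assms(1) by (rule someI)
  then show ?thesis
    unfolding pitman_elt_def us_def[symmetric] using assms
    by (intro pitman_word_braid_equiv matsumoto) (auto simp: reduced_decomposition_iff)
qed

lemma pitman_longest_factors:
  assumes "longest_element W S w0" "s \<in> S" "0 \<le> T" "\<eta> \<in> paths T" "\<xi> \<in> paths T"
    and "pitman sroot coroot T s \<xi> = pitman sroot coroot T s \<eta>"
  shows "pitman_elt W S sroot coroot T w0 \<xi> = pitman_elt W S sroot coroot T w0 \<eta>"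
proof -
  obtain us where "reduced_decomposition W S w0 (us @ [s])"
    using longest_element_ends_with assms by blast
  then show ?thesis using assms by (simp add: pitman_elt_eq_word pitman_word_append)
qed

section \<open>String operators and the crystal axioms\<close>

text \<open>Existence and uniqueness within a string replace the definite description by its
  defining relation; the axioms then reduce to comparing end points.\<close>

lemma path_e_eq_Some_iff:
  assumes s: "s \<in> S" and T: "0 \<le> T" and \<eta>: "\<eta> \<in> paths T"
  shows "path_e sroot coroot T s x (Some \<eta>) = Some \<xi> \<longleftrightarrow> \<xi> \<in> paths T \<and>
    pitman sroot coroot T s \<xi> = pitman sroot coroot T s \<eta> \<and> \<xi> T = \<eta> T + x *\<^sub>R sroot s"
    (is "_ \<longleftrightarrow> ?P \<xi>")
    and path_e_nonempty_iff: "path_e sroot coroot T s x (Some \<eta>) \<noteq> None \<longleftrightarrow>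
      - path_phi coroot T s \<eta> \<le> x \<and> x \<le> path_eps coroot T s \<eta>"
proof -
  interpret root_direction T "sroot s" "coroot s" using s T by (rule root_direction)
  have range: "- path_phi coroot T s \<eta> \<le> x \<and> x \<le> path_eps coroot T s \<eta> \<longleftrightarrow> (\<exists>\<xi>. ?P \<xi>)"
    using string_exists_iff[OF \<eta>, of x]
    by (auto simp: path_phi_eq path_eps_eq pitman_eq_pitman_along)
  have unique: "\<xi>' = \<xi>" if "?P \<xi>" "?P \<xi>'" for \<xi> \<xi>'
    using that pit_string_unique[of \<xi> \<xi>'] by (simp add: pitman_eq_pitman_along)
  have "(THE \<xi>. ?P \<xi>) = \<xi>" if "?P \<xi>" for \<xi>
    using that unique by (intro the_equality) auto
  then show "path_e sroot coroot T s x (Some \<eta>) = Some \<xi> \<longleftrightarrow> ?P \<xi>"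
    using range by (auto simp: path_e_def)
  show "path_e sroot coroot T s x (Some \<eta>) \<noteq> None \<longleftrightarrow>
      - path_phi coroot T s \<eta> \<le> x \<and> x \<le> path_eps coroot T s \<eta>"
    by (auto simp: path_e_def)
qed

lemma path_e_string:
  assumes "s \<in> S" "0 \<le> T" "\<eta> \<in> paths T" "path_e sroot coroot T s x (Some \<eta>) = Some \<xi>"
  shows "path_eps coroot T s \<xi> = path_eps coroot T s \<eta> - x"
    and "path_phi coroot T s \<xi> = path_phi coroot T s \<eta> + x"
proof -
  interpret root_direction T "sroot s" "coroot s" using assms by (intro root_direction)
  have \<xi>: "pit \<xi> = pit \<eta>" "\<xi> T = \<eta> T + x *\<^sub>R sroot s"
    using assms by (auto simp: path_e_eq_Some_iff pitman_eq_pitman_along)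
  then show "path_eps coroot T s \<xi> = path_eps coroot T s \<eta> - x"
    using inf_coroot_of_string[OF \<xi>] by (simp add: path_eps_eq)
  then show "path_phi coroot T s \<xi> = path_phi coroot T s \<eta> + x"
    by (simp add: path_phi_eq \<xi>(2) coroot_simps coroot_self)
qed

text \<open>Both sides are described by the same transform and the same end point, hence they also
  agree when they are the ghost.\<close>

lemma path_e_add:
  assumes "s \<in> S" "0 \<le> T" "\<eta> \<in> paths T" "path_e sroot coroot T s x (Some \<eta>) = Some \<xi>"
  shows "path_e sroot coroot T s (y + x) (Some \<eta>) = path_e sroot coroot T s y (Some \<xi>)"
proof -
  have \<xi>: "\<xi> \<in> paths T" "pitman sroot coroot T s \<xi> = pitman sroot coroot T s \<eta>"
      "\<xi> T = \<eta> T + x *\<^sub>R sroot s"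
    using assms by (auto simp: path_e_eq_Some_iff)
  have "path_e sroot coroot T s (y + x) (Some \<eta>) = Some \<zeta> \<longleftrightarrow> path_e sroot coroot T s y (Some \<xi>) = Some \<zeta>" for \<zeta>
    using assms \<xi> by (simp add: path_e_eq_Some_iff algebra_simps)
  then show ?thesis by (metis option.exhaust)
qed

lemma path_eps_phi_nonneg:
  assumes "s \<in> S" "0 \<le> T" "\<eta> \<in> paths T"
  shows "0 \<le> path_eps coroot T s \<eta>" "0 \<le> path_phi coroot T s \<eta>"
proof -
  interpret root_direction T "sroot s" "coroot s" using assms by (intro root_direction)
  show "0 \<le> path_eps coroot T s \<eta>" "0 \<le> path_phi coroot T s \<eta>"
    using inf_coroot_nonpos[of \<eta> T] inf_coroot_le[of \<eta> T T] assms
    by (auto simp: path_phi_eq path_eps_eq)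
qed

text \<open>Closure is the axiom that depends on the fibre: string operators keep the transform
  along \<open>s\<close>, through which that of \<open>w0\<close> factors. The others hold for all
  paths.\<close>

lemma normal_continuous_crystal_pitman_fibre:
  assumes w0: "longest_element W S w0" and T: "0 \<le> T"
  shows "normal_continuous_crystal S sroot coroot (pitman_fibre W S sroot coroot T w0 \<pi>)
      (path_wt T) (\<lambda>s \<eta>. ereal (path_eps coroot T s \<eta>)) (\<lambda>s \<eta>. ereal (path_phi coroot T s \<eta>))
      (path_e sroot coroot T)"
proof -
  let ?L = "pitman_fibre W S sroot coroot T w0 \<pi>"
  have paths: "\<eta> \<in> paths T" if "\<eta> \<in> ?L" for \<eta>
    using that by (simp add: pitman_fibre_def)
  show ?thesis
  proof
    fix s \<eta> r assume s: "s \<in> S" and \<eta>: "\<eta> \<in> ?L"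
    show "path_e sroot coroot T s r (Some \<eta>) \<in> insert None (Some ` ?L)"
    proof (cases "path_e sroot coroot T s r (Some \<eta>)")
      case (Some \<xi>)
      then have "\<xi> \<in> paths T" "pitman sroot coroot T s \<xi> = pitman sroot coroot T s \<eta>"
        using s T paths[OF \<eta>] by (auto simp: path_e_eq_Some_iff)
      then have "\<xi> \<in> ?L"
        using pitman_longest_factors[OF w0 s T paths[OF \<eta>]] \<eta> by (simp add: pitman_fibre_def)
      then show ?thesis using Some by simp
    qed simp
  next
    fix s \<eta> r \<xi> assume "s \<in> S" and \<eta>: "\<eta> \<in> ?L" and "path_e sroot coroot T s r (Some \<eta>) = Some \<xi>"
    then show "ereal (path_eps coroot T s \<xi>) = ereal (path_eps coroot T s \<eta>) - ereal r \<and>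
      ereal (path_phi coroot T s \<xi>) = ereal (path_phi coroot T s \<eta>) + ereal r \<and>
      path_wt T \<xi> = path_wt T \<eta> + r *\<^sub>R sroot s"
      using path_e_string[of s T \<eta> r \<xi>] T paths[OF \<eta>] by (auto simp: path_e_eq_Some_iff path_wt_def)
  next
    fix s \<eta> assume "s \<in> S" and \<eta>: "\<eta> \<in> ?L"
    then show "path_e sroot coroot T s 0 (Some \<eta>) = Some \<eta>"
      using T paths[OF \<eta>] by (simp add: path_e_eq_Some_iff)
  next
    fix s \<eta> x y assume "s \<in> S" and \<eta>: "\<eta> \<in> ?L" and "path_e sroot coroot T s x (Some \<eta>) \<noteq> None"
    then show "path_e sroot coroot T s (y + x) (Some \<eta>) =
        path_e sroot coroot T s y (path_e sroot coroot T s x (Some \<eta>))"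
      using path_e_add[of s T \<eta> x] T paths[OF \<eta>] by auto
  next
    fix s \<eta> assume s: "s \<in> S" and \<eta>: "\<eta> \<in> ?L"
    note nonneg = path_eps_phi_nonneg[OF s T paths[OF \<eta>]]
    note nonempty = path_e_nonempty_iff[OF s T paths[OF \<eta>]]
    show "is_maximum {r. 0 \<le> r \<and> path_e sroot coroot T s r (Some \<eta>) \<noteq> None} (ereal (path_eps coroot T s \<eta>))"
      unfolding is_maximum_def nonempty
      by (rule bexI[of _ "path_eps coroot T s \<eta>"]) (use nonneg in auto)
    show "is_maximum {r. 0 \<le> r \<and> path_e sroot coroot T s (- r) (Some \<eta>) \<noteq> None} (ereal (path_phi coroot T s \<eta>))"
      unfolding is_maximum_def nonempty
      by (rule bexI[of _ "path_phi coroot T s \<eta>"]) (use nonneg in auto)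
  qed (auto simp: path_phi_eq path_wt_def path_e_def)
qed

section \<open>Generation from the highest weight path\<close>

text \<open>Each intermediate path \<open>?\<rho>\<close> is recovered from its transform by
  lowering with \<open>path_eps coroot T s ?\<rho>\<close>, the multiple of the root that the
  transform added at time \<open>T\<close>.\<close>

lemma string_coordinates:
  assumes "set ws \<subseteq> S" "0 \<le> T" "\<eta> \<in> paths T"
  obtains irs where "set irs \<subseteq> S \<times> {0..}"
    "Some \<eta> = foldr (\<lambda>(s, r). path_e sroot coroot T s (- r)) irs (Some (pitman_word sroot coroot T ws \<eta>))"
proof -
  have "\<exists>irs. set irs \<subseteq> S \<times> {0..} \<and>
    Some \<eta> = foldr (\<lambda>(s, r). path_e sroot coroot T s (- r)) irs (Some (pitman_word sroot coroot T ws \<eta>))"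
    using assms(1)
  proof (induction ws)
    case Nil
    show ?case by (rule exI[of _ "[]"]) simp
  next
    case (Cons s ws)
    then obtain irs where irs: "set irs \<subseteq> S \<times> {0..}"
      "Some \<eta> = foldr (\<lambda>(s, r). path_e sroot coroot T s (- r)) irs (Some (pitman_word sroot coroot T ws \<eta>))"
      by auto
    let ?\<rho> = "pitman_word sroot coroot T ws \<eta>"
    interpret root_direction T "sroot s" "coroot s" using Cons.prems assms(2) by (intro root_direction) auto
    have \<rho>: "?\<rho> \<in> paths T" using Cons.prems assms by (intro pitman_word_paths) auto
    have "path_e sroot coroot T s (- path_eps coroot T s ?\<rho>) (Some (pit ?\<rho>)) = Some ?\<rho>"
      using Cons.prems assms(2) \<rho>
      by (simp add: path_e_eq_Some_iff pit_paths pit_idem pitman_eq_pitman_along path_eps_eq pit_apply)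
    \<comment> \<open>The outermost transform is undone first, and \<open>foldr\<close> applies the
      last entry first, so the new pair goes to the end of the list.\<close>
    then show ?case
      using irs path_eps_phi_nonneg(1)[OF _ assms(2) \<rho>] Cons.prems
      by (intro exI[of _ "irs @ [(s, path_eps coroot T s ?\<rho>)]"])
        (auto simp: pitman_eq_pitman_along[of sroot coroot T s])
  qed
  then show ?thesis using that by blast
qed

lemma pitman_word_dominant:
  assumes "set ws \<subseteq> S" "0 \<le> T" "\<pi> \<in> paths T" "dominant S coroot T \<pi>"
  shows "pitman_word sroot coroot T ws \<pi> = \<pi>"
  using assms(1)
proof (induction ws)
  case (Cons s ws)
  interpret root_direction T "sroot s" "coroot s" using Cons.prems assms(2) by (intro root_direction) auto
  show ?case
    using Cons assms pit_eq_self[of \<pi>]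
    by (simp add: pitman_eq_pitman_along[of sroot coroot T s] dominant_def closed_chamber_def)
qed simp

text \<open>The highest weight element is \<open>\<pi>\<close> itself: dominance makes it a fixed
  point of every transform, hence a member of its fibre, and makes its infima 0, so that it cannot
  be raised.\<close>

lemma has_highest_weight_pitman_fibre:
  assumes w0: "w0 \<in> carrier W" and T: "0 \<le> T"
    and \<pi>: "\<pi> \<in> paths T" "dominant S coroot T \<pi>"
  shows "has_highest_weight S (pitman_fibre W S sroot coroot T w0 \<pi>)
      (path_wt T) (path_e sroot coroot T) (\<pi> T)"
proof -
  let ?L = "pitman_fibre W S sroot coroot T w0 \<pi>"
  obtain ws where ws: "reduced_decomposition W S w0 ws"
    using reduced_decomposition_exists[OF w0] by blast
  then have S: "set ws \<subseteq> S" by (auto simp: reduced_decomposition_def in_lists_conv_set)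
  have L: "\<eta> \<in> ?L \<longleftrightarrow> \<eta> \<in> paths T \<and> pitman_word sroot coroot T ws \<eta> = \<pi>" for \<eta>
    using pitman_elt_eq_word[OF ws T] by (auto simp: pitman_fibre_def)
  have "path_e sroot coroot T s r (Some \<pi>) = None" if s: "s \<in> S" and r: "r > 0" for s r
  proof -
    interpret root_direction T "sroot s" "coroot s" using s T by (intro root_direction)
    have "inf_coroot \<pi> T = 0"
      using s T \<pi> by (intro inf_coroot_eq_0) (auto simp: dominant_def closed_chamber_def)
    then show ?thesis using path_e_nonempty_iff[OF s T \<pi>(1), of r] r by (auto simp: path_eps_eq)
  qed
  moreover have "\<pi> \<in> ?L" using pitman_word_dominant[OF S T \<pi>] \<pi> L by simp
  moreover have "\<exists>irs. set irs \<subseteq> S \<times> {0..} \<and>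
      Some \<eta> = foldr (\<lambda>(i, r). path_e sroot coroot T i (- r)) irs (Some \<pi>)" if "\<eta> \<in> ?L" for \<eta>
    using string_coordinates[OF S T, of \<eta>] that L by metis
  ultimately show ?thesis
    unfolding has_highest_weight_def by (intro bexI[of _ \<pi>]) (auto simp: path_wt_def)
qed

end

theorem theorem3p11:
  fixes W :: "('g, 'm) monoid_scheme" and S :: "'g set"
    and act :: "'g \<Rightarrow> 'v \<Rightarrow> 'v::real_normed_vector"
    and sroot :: "'g \<Rightarrow> 'v" and coroot :: "'g \<Rightarrow> 'v \<Rightarrow> real"
    and w0 :: 'g and T :: real and \<pi> :: "real \<Rightarrow> 'v"
  assumes "coxeter_realization W S act sroot coroot"
    and "finite (carrier W)"
    and "longest_element W S w0"
    and "T > 0"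
    and "\<pi> \<in> paths T"
    and "dominant S coroot T \<pi>"
  shows "normal_continuous_crystal S sroot coroot (pitman_fibre W S sroot coroot T w0 \<pi>)
      (path_wt T) (\<lambda>s \<eta>. ereal (path_eps coroot T s \<eta>)) (\<lambda>s \<eta>. ereal (path_phi coroot T s \<eta>))
      (path_e sroot coroot T)
    \<and> has_highest_weight S (pitman_fibre W S sroot coroot T w0 \<pi>)
      (path_wt T) (path_e sroot coroot T) (\<pi> T)"
proof -
  interpret coxeter_realization W S act sroot coroot by fact
  show ?thesis
    using normal_continuous_crystal_pitman_fibre[of w0 T] has_highest_weight_pitman_fibre[of w0 T \<pi>] assms
    by (simp add: longest_element_def)
qed

end
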